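(* Let $N\geq3$, $1\leq d<N$ be integers, $0<r\leq p<q\leq\infty$, $s>\sigma_p$, and let $\chi=\frac{qr}{q-r}$ if $q<\infty$ and $\chi=r$ if $q=\infty$. Let $\Phi$ and $\Psi$ be two admissible functions such that $$\sum_{j\geq0}\Phi(2^{-j})^{-\chi}\Psi(2^{-j})^{\chi}<\infty.$$ Let $K\subset\mathbb{R}^{N-d}$ be a compact set. Then there is a constant $C>0$, independent of $f$, such that for every $f\in B_{p,q}^{(s,\Phi)}(\mathbb{R}^N)$, $$\left(\int_K\|f(\cdot,x'')\|_{B_{p,r}^{(s,\Psi)}(\mathbb{R}^d)}^r\,\mathrm{d}x''\right)^{1/r}\leq C\,\|f\|_{B_{p,q}^{(s,\Phi)}(\mathbb{R}^N)}.$$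
   Context: $\sigma_p:=N\left(\frac1p-1\right)_+$ with $x_+=\max\{0,x\}$. Points of $\mathbb{R}^N$ are written $(x',x'')$ with $x'\in\mathbb{R}^d$, $x''\in\mathbb{R}^{N-d}$, and $f(\cdot,x'')$ is the function $x'\mapsto f(x',x'')$ on $\mathbb{R}^d$. A real function $\Psi$ on $(0,1]$ is called admissible if it is positive and monotone on $(0,1]$ and $\Psi(2^{-j})\sim\Psi(2^{-2j})$ for all $j\in\mathbb{N}=\{0,1,2,\dots\}$, i.e. there are constants $0<c\le C$ with $c\,\Psi(2^{-2j})\leq\Psi(2^{-j})\leq C\,\Psi(2^{-2j})$ for all $j$. For $M\in\{1,2,\dots\}$ and $h\in\mathbb{R}^n$, $\Delta_h^Mf(x)=\sum_{j=0}^M(-1)^{M-j}\binom{M}{j}f(x+hj)$. Let $n\geq1$, $0<p,q\leq\infty$, $s>n(\frac1p-1)_+$ with $s>0$, and let $M>s$ be a fixed integer. For $\Psi$ admissible, the Besov space of generalized smoothness $B_{p,q}^{(s,\Psi)}(\mathbb{R}^n)$ is the set of all $f\in L^p(\mathbb{R}^n)$ with $$[f]_{B_{p,q}^{(s,\Psi)}(\mathbb{R}^n)}:=\left(\int_0^1\sup_{|h|\leq t}\|\Delta_h^Mf\|_{L^p(\mathbb{R}^n)}^q\frac{\Psi(t)^q}{t^{1+sq}}\,\mathrm{d}t\right)^{1/q}<\infty,$$ which for $q=\infty$ means $[f]_{B_{p,\infty}^{(s,\Psi)}(\mathbb{R}^n)}:=\sup_{0<t\leq1}t^{-s}\Psi(t)\sup_{|h|\leq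 t}\|\Delta_h^Mf\|_{L^p(\mathbb{R}^n)}<\infty$. It is endowed with the quasi-norm $\|f\|_{B_{p,q}^{(s,\Psi)}(\mathbb{R}^n)}:=\|f\|_{L^p(\mathbb{R}^n)}+[f]_{B_{p,q}^{(s,\Psi)}(\mathbb{R}^n)}$ (set equal to $+\infty$ if $f$ is not in the space). Different choices of $M>s$ give equivalent quasi-norms. *)

theory Defs
  imports "HOL-Analysis.Analysis" "HOL-Probability.Essential_Supremum"
begin

definition sigma_p :: "nat \<Rightarrow> real \<Rightarrow> real" where
  "sigma_p n p = real n * max 0 (1 / p - 1)"

definition admissible :: "(real \<Rightarrow> real) \<Rightarrow> bool" where
  "admissible \<Psi> \<longleftrightarrow>
     (\<forall>t\<in>{0<..1}. 0 < \<Psi> t) \<and>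
     (mono_on {0<..1} \<Psi> \<or> antimono_on {0<..1} \<Psi>) \<and>
     (\<exists>c C. 0 < c \<and> c \<le> C \<and>
        (\<forall>j::nat. c * \<Psi> (2 powr - real (2 * j)) \<le> \<Psi> (2 powr - real j) \<and>
                  \<Psi> (2 powr - real j) \<le> C * \<Psi> (2 powr - real (2 * j))))"

(* Only used for exponents a > 0, so that infinity is mapped to infinity. *)
definition enn_powr :: "ennreal \<Rightarrow> real \<Rightarrow> ennreal" where
  "enn_powr x a = (if x = \<infinity> then \<infinity> else ennreal (enn2real x powr a))"

(* Exponents range over 0 < p \<le> \<infinity>. *)
definition Lp_qnorm :: "ereal \<Rightarrow> ('a::euclidean_space \<Rightarrow> complex) \<Rightarrow> ennreal" where
  "Lp_qnorm p f =
     (if p = \<infinity> then esssup lebesgue (\<lambda>x. ennreal (norm (f x)))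
      else enn_powr (\<integral>\<^sup>+x. ennreal (norm (f x) powr real_of_ereal p) \<partial>lebesgue)
             (1 / real_of_ereal p))"

(* Functions rather than almost-everywhere classes: all quantities below depend only on the
   class of f. *)
definition Lp_functions :: "ereal \<Rightarrow> ('a::euclidean_space \<Rightarrow> complex) set" where
  "Lp_functions p = {f. f \<in> borel_measurable lebesgue \<and> Lp_qnorm p f < \<infinity>}"

definition fdiff :: "nat \<Rightarrow> 'a::euclidean_space \<Rightarrow> ('a \<Rightarrow> complex) \<Rightarrow> 'a \<Rightarrow> complex" where
  "fdiff M h f x = (\<Sum>j\<le>M. (-1) ^ (M - j) * of_nat (M choose j) * f (x + real j *\<^sub>R h))"

definition Lp_modulus :: "nat \<Rightarrow> ereal \<Rightarrow> ('a::euclidean_space \<Rightarrow> complex) \<Rightarrow> real \<Rightarrow> ennreal" where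
  "Lp_modulus M p f t = (SUP h\<in>{h. norm h \<le> t}. Lp_qnorm p (fdiff M h f))"

(* In the following definitions M is the order of the differences (an integer M > s);
   the dimension of the underlying space is given by the type 'a. *)
definition besov_seminorm ::
    "nat \<Rightarrow> real \<Rightarrow> (real \<Rightarrow> real) \<Rightarrow> ereal \<Rightarrow> ereal \<Rightarrow> ('a::euclidean_space \<Rightarrow> complex) \<Rightarrow> ennreal"
where
  "besov_seminorm M s \<Psi> p q f =
     (if q = \<infinity> then SUP t\<in>{0<..1}. ennreal (t powr - s * \<Psi> t) * Lp_modulus M p f t
      else enn_powr
             (\<integral>\<^sup>+t\<in>{0<..1}. (enn_powr (Lp_modulus M p f t) (real_of_ereal q) *
                 ennreal (\<Psi> t powr real_of_ereal q / t powr (1 + s * real_of_ereal q))) \<partial>lebesgue)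
             (1 / real_of_ereal q))"

definition besov_space ::
    "nat \<Rightarrow> real \<Rightarrow> (real \<Rightarrow> real) \<Rightarrow> ereal \<Rightarrow> ereal \<Rightarrow> ('a::euclidean_space \<Rightarrow> complex) set"
where
  "besov_space M s \<Psi> p q = {f \<in> Lp_functions p. besov_seminorm M s \<Psi> p q f < \<infinity>}"

definition besov_qnorm ::
    "nat \<Rightarrow> real \<Rightarrow> (real \<Rightarrow> real) \<Rightarrow> ereal \<Rightarrow> ereal \<Rightarrow> ('a::euclidean_space \<Rightarrow> complex) \<Rightarrow> ennreal"
where
  "besov_qnorm M s \<Psi> p q f =
     (if f \<in> besov_space M s \<Psi> p q then Lp_qnorm p f + besov_seminorm M s \<Psi> p q f else \<infinity>)"

end

theory Submission
  imports Defs
begin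

text \<open>
  Write \<open>\<omega>(g, t)\<close> for the \<open>L\<^sup>p\<close> modulus of smoothness of order \<open>M\<close>. The difficulty is that
  the Besov quasi-norm of a slice \<open>f(\<cdot>, y)\<close> contains a supremum over all steps of length at most
  \<open>t\<close>, taken separately for each \<open>y\<close>, whereas the quasi-norm of \<open>f\<close> only controls differences with
  one step common to all slices. The supremum is therefore replaced by an average. An algebraic
  identity expresses a difference with step \<open>h\<close> through differences with steps \<open>j u\<close> and
  \<open>h + j u\<close>, where \<open>u\<close> is arbitrary (\<open>fdiff_free_step\<close>). Averaged over \<open>|u| \<le> t\<close> it bounds
  \<open>\<omega>(f(\<cdot>, y), t)\<^sup>p\<close> by an average over \<open>w\<close> of the \<open>p\<close>-th powers of \<open>L\<^sup>p\<close> quasi-norms of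
  differences of the slice with steps \<open>j w\<close> (\<open>Lp_modulus_slice_le\<close>). This average can be integrated
  over \<open>y\<close> by Tonelli, and a doubling inequality for moduli leads to
  \<open>\<integral> slice average dy \<le> C \<omega>(f, t)\<^sup>p\<close> (\<open>slice_average_integral_le_modulus\<close>). Only the inequality
  \<open>|\<Sum> z\<^sub>i|\<^sup>p \<le> n\<^sup>p \<Sum> |z\<^sub>i|\<^sup>p\<close> is used for \<open>L\<^sup>p\<close>, so all \<open>p > 0\<close> are treated alike.

  The rest is one-dimensional. Moduli are monotone and admissible functions are essentially constant
  on dyadic intervals, so the integrals over \<open>t\<close> become sums over \<open>t = 2\<^sup>-\<^sup>j\<close>
  (\<open>besov_seminorm_le_dyadic\<close>, \<open>dyadic_le_besov_seminorm\<close>). Since \<open>r \<le> p\<close> and \<open>K\<close> has finite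
  measure, the integral over \<open>K\<close> of the \<open>r\<close>-th power of \<open>\<omega>(f(\<cdot>, y), 2\<^sup>-\<^sup>j)\<close> is at most
  \<open>C \<omega>(f, 2\<^sup>-\<^sup>j)\<^sup>r\<close> (\<open>nn_integral_enn_powr_le\<close>). It remains to bound
  \<open>\<Sum>\<^sub>j 2\<^sup>j\<^sup>s\<^sup>r \<Psi>(2\<^sup>-\<^sup>j)\<^sup>r \<omega>(f, 2\<^sup>-\<^sup>j)\<^sup>r\<close> by the \<open>r\<close>-th power of the seminorm with parameters
  \<open>q\<close> and \<open>\<Phi>\<close>, and this is Hoelder's inequality with the sequence \<open>\<Psi>(2\<^sup>-\<^sup>j) / \<Phi>(2\<^sup>-\<^sup>j)\<close>, which
  is in \<open>l\<^sup>\<kappa>\<close> by assumption (\<open>dyadic_sum_le_besov_seminorm\<close>).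

  All of this is done for Borel functions. A general \<open>f\<close> agrees almost everywhere with a Borel
  function, and then almost all slices agree almost everywhere, which changes neither side.
\<close>

section \<open>Real powers of extended nonnegative numbers\<close>

lemma enn_powr_ennreal: "0 \<le> x \<Longrightarrow> enn_powr (ennreal x) a = ennreal (x powr a)"
  by (simp add: enn_powr_def)

lemma enn_powr_top [simp]: "enn_powr top a = top"
  by (simp add: enn_powr_def)

lemma enn_powr_zero [simp]: "enn_powr 0 a = 0"
  by (simp add: enn_powr_def)

lemma enn_powr_one [simp]: "enn_powr x 1 = x"
  by (cases x rule: ennreal_cases) (auto simp: enn_powr_ennreal)

lemma enn_powr_mono: "0 \<le> a \<Longrightarrow> x \<le> y \<Longrightarrow> enn_powr x a \<le> enn_powr y a"
  by (cases x rule: ennreal_cases; cases y rule: ennreal_cases)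
     (auto simp: enn_powr_ennreal top_unique intro!: ennreal_leI powr_mono2)

lemma enn_powr_powr: "enn_powr (enn_powr x a) b = enn_powr x (a * b)"
  by (cases x rule: ennreal_cases) (auto simp: enn_powr_ennreal powr_powr)

lemma enn_powr_cmult:
  "0 < c \<Longrightarrow> enn_powr (ennreal c * x) a = ennreal (c powr a) * enn_powr x a"
  by (cases x rule: ennreal_cases)
     (auto simp: enn_powr_ennreal powr_mult ennreal_mult_top simp flip: ennreal_mult)

lemma measurable_enn_powr [measurable]:
  assumes [measurable]: "f \<in> borel_measurable M"
  shows "(\<lambda>x. enn_powr (f x) a) \<in> borel_measurable M"
  unfolding enn_powr_def by measurable

text \<open>The sum is at most the number of terms times the largest one. Unlike convexity or subadditivity,
  this argument covers exponents on both sides of \<open>1\<close>.\<close>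

lemma powr_sum_le:
  fixes x :: "'i \<Rightarrow> real"
  assumes "finite I" "\<And>i. i \<in> I \<Longrightarrow> 0 \<le> x i" "0 < a"
  shows "(\<Sum>i\<in>I. x i) powr a \<le> real (card I) powr a * (\<Sum>i\<in>I. x i powr a)"
proof (cases "I = {}")
  case False
  define m where "m = Max (x ` I)"
  have "m \<in> x ` I" unfolding m_def using assms(1) False by simp
  then obtain k where k: "k \<in> I" "m = x k" by auto
  have "(\<Sum>i\<in>I. x i) \<le> real (card I) * m"
    by (rule sum_bounded_above) (auto simp: m_def assms(1))
  then have "(\<Sum>i\<in>I. x i) powr a \<le> (real (card I) * m) powr a"
    using assms by (intro powr_mono2 sum_nonneg) auto
  also have "\<dots> = real (card I) powr a * x k powr a"
    using k assms(2) by (simp add: powr_mult)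
  also have "\<dots> \<le> real (card I) powr a * (\<Sum>i\<in>I. x i powr a)"
    using k assms(1) by (intro mult_left_mono member_le_sum[where f = "\<lambda>i. x i powr a"]) auto
  finally show ?thesis .
qed simp

lemma enn_powr_add_le:
  assumes "0 < a"
  shows "enn_powr (x + y) a \<le> ennreal (2 powr a) * (enn_powr x a + enn_powr y a)"
proof (cases "x = top \<or> y = top")
  case True
  then show ?thesis by (auto simp: ennreal_mult_top)
next
  case False
  then obtain u v where uv: "x = ennreal u" "0 \<le> u" "y = ennreal v" "0 \<le> v"
    by (metis ennreal_cases)
  have "(u + v) powr a \<le> 2 powr a * (u powr a + v powr a)"
    using powr_sum_le[of "UNIV :: bool set" "\<lambda>b. if b then u else v" a] uv assms
    by (simp add: UNIV_bool add.commute)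
  then show ?thesis
    using uv by (simp add: enn_powr_ennreal ennreal_leI flip: ennreal_plus ennreal_mult)
qed

section \<open>Finite differences\<close>

text \<open>Pascal's rule in summed form. Both recursions for iterated differences below, in the order and
  in the step, reduce to it.\<close>

lemma sum_choose_Suc:
  fixes u :: "nat \<Rightarrow> complex"
  shows "(\<Sum>i\<le>Suc n. of_nat (Suc n choose i) * u i)
    = (\<Sum>i\<le>n. of_nat (n choose i) * (u i + u (Suc i)))"
proof -
  have "(\<Sum>i\<le>Suc n. of_nat (Suc n choose i) * u i)
      = u 0 + (\<Sum>i\<le>n. of_nat (Suc n choose Suc i) * u (Suc i))"
    by (simp add: sum.atMost_Suc_shift del: sum.atMost_Suc binomial_Suc_Suc)
  also have "\<dots> = (u 0 + (\<Sum>i\<le>n. of_nat (n choose Suc i) * u (Suc i)))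
      + (\<Sum>i\<le>n. of_nat (n choose i) * u (Suc i))"
    by (simp add: algebra_simps sum.distrib)
  also have "u 0 + (\<Sum>i\<le>n. of_nat (n choose Suc i) * u (Suc i))
      = (\<Sum>i\<le>Suc n. of_nat (n choose i) * u i)"
    by (simp add: sum.atMost_Suc_shift del: sum.atMost_Suc)
  also have "\<dots> = (\<Sum>i\<le>n. of_nat (n choose i) * u i)"
    by simp
  finally show ?thesis by (simp add: algebra_simps sum.distrib)
qed

lemma fdiff_Suc: "fdiff (Suc M) h f x = fdiff M h f (x + h) - fdiff M h f x"
proof -
  have sgn: "(- 1 :: complex) ^ (m - j) = (- 1) ^ m * (- 1) ^ j" if "j \<le> m" for m j :: nat
    using that by (simp add: minus_one_power_iff)
  have expand: "fdiff m h f y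
      = (\<Sum>j\<le>m. of_nat (m choose j) * ((- 1) ^ m * (- 1) ^ j * f (y + real j *\<^sub>R h)))" for m y
    unfolding fdiff_def by (intro sum.cong) (auto simp: sgn)
  show ?thesis
    unfolding expand sum_choose_Suc sum_subtractf[symmetric]
    by (intro sum.cong) (simp_all add: algebra_simps scaleR_add_left)
qed

text \<open>Operator form: with \<open>T\<close> the translation by \<open>h\<close>, this is
  \<open>(T\<^sup>2 - 1)\<^sup>M = (T + 1)\<^sup>M (T - 1)\<^sup>M\<close>. It is what allows step sizes to be doubled at the
  cost of a constant.\<close>

lemma fdiff_double:
  "fdiff M (2 *\<^sub>R h) f x = (\<Sum>i\<le>M. of_nat (M choose i) * fdiff M h f (x + real i *\<^sub>R h))"
proof (induction M arbitrary: x)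
  case 0
  show ?case by (simp add: fdiff_def)
next
  case (Suc M)
  have "fdiff (Suc M) (2 *\<^sub>R h) f x
     = (\<Sum>i\<le>M. of_nat (M choose i) * (fdiff (Suc M) h f (x + real i *\<^sub>R h)
          + fdiff (Suc M) h f (x + real (Suc i) *\<^sub>R h)))"
    unfolding fdiff_Suc Suc.IH sum_subtractf[symmetric]
    by (intro sum.cong refl) (simp add: algebra_simps scaleR_add_left scaleR_2)
  then show ?case unfolding sum_choose_Suc .
qed

lemma fdiff_zero_step: "0 < M \<Longrightarrow> fdiff M 0 f x = 0"
  by (cases M) (simp_all add: fdiff_Suc)

text \<open>Both sides arise, up to the sign \<open>(-1)\<^sup>M\<close>, from the double sum of
  \<open>(-1)\<^sup>j\<^sup>+\<^sup>k (M choose j) (M choose k) f (x + k h + j k u)\<close>. Summed over \<open>k\<close> first it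
  gives differences with steps \<open>h + j u\<close>, of which \<open>j = 0\<close> is the one on the left; summed over
  \<open>j\<close> first it gives differences with steps \<open>k u\<close>, of which \<open>k = 0\<close> vanishes. The vector \<open>u\<close>
  is free, so the identity can be averaged over it, and then a difference with one prescribed step
  is controlled by an average over all steps.\<close>

lemma fdiff_free_step:
  assumes "0 < M"
  shows "fdiff M h f x = (\<Sum>j\<in>{1..M}. (- 1) ^ j * of_nat (M choose j) *
     (fdiff M (real j *\<^sub>R u) f (x + real j *\<^sub>R h) - fdiff M (h + real j *\<^sub>R u) f x))"
proof -
  define P where "P j = fdiff M (real j *\<^sub>R u) f (x + real j *\<^sub>R h)" for j
  define Q where "Q j = fdiff M (h + real j *\<^sub>R u) f x" for j
  define c where "c j = (- 1) ^ j * (of_nat (M choose j) :: complex)" for j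
  have sgn: "(- 1 :: complex) ^ M * (- 1) ^ j = (- 1) ^ (M - j)" if "j \<le> M" for j
    using that by (simp add: minus_one_power_iff)
  \<comment> \<open>The double sum, to be summed in the two orders.\<close>
  have "(\<Sum>j\<le>M. c j * Q j) = (\<Sum>j\<le>M. \<Sum>k\<le>M. c j * ((- 1) ^ (M - k) * of_nat (M choose k)
      * f (x + real k *\<^sub>R h + (real j * real k) *\<^sub>R u)))"
    unfolding Q_def fdiff_def sum_distrib_left
    by (intro sum.cong refl) (simp add: scaleR_add_right mult.commute add.assoc)
  also have "\<dots> = (\<Sum>k\<le>M. \<Sum>j\<le>M. c k * ((- 1) ^ (M - j) * of_nat (M choose j)
      * f (x + real k *\<^sub>R h + (real j * real k) *\<^sub>R u)))"
    apply (subst sum.swap)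
    apply (intro sum.cong refl)
    by (simp add: c_def flip: sgn)
  also have "\<dots> = (\<Sum>k\<le>M. c k * P k)"
    unfolding P_def fdiff_def sum_distrib_left by (intro sum.cong refl) (simp add: mult.commute)
  finally have eq: "(\<Sum>j\<le>M. c j * Q j) = (\<Sum>j\<le>M. c j * P j)" .
  have split: "(\<Sum>j\<le>M. c j * R j) = R 0 + (\<Sum>j\<in>{1..M}. c j * R j)" for R :: "nat \<Rightarrow> complex"
    by (simp add: c_def atMost_atLeast0 sum.atLeast_Suc_atMost)
  have "Q 0 + (\<Sum>j\<in>{1..M}. c j * Q j) = (\<Sum>j\<in>{1..M}. c j * P j)"
    using eq assms unfolding split by (simp add: P_def fdiff_zero_step)
  then have "Q 0 = (\<Sum>j\<in>{1..M}. c j * (P j - Q j))"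
    by (simp add: right_diff_distrib sum_subtractf eq_diff_eq)
  then show ?thesis by (simp add: P_def Q_def c_def)
qed

lemma fdiff_slice: "fdiff M (h, 0) f (x, y) = fdiff M h (\<lambda>x. f (x, y)) x"
  by (simp add: fdiff_def)

lemma measurable_fdiff [measurable]:
  fixes f :: "'a::euclidean_space \<Rightarrow> complex"
  assumes [measurable]: "f \<in> borel_measurable borel" "h \<in> borel_measurable N" "g \<in> borel_measurable N"
  shows "(\<lambda>z. fdiff M (h z) f (g z)) \<in> borel_measurable N"
  unfolding fdiff_def by measurable

lemma norm_powr_sum_le:
  fixes z :: "'i \<Rightarrow> complex"
  assumes "finite I" "\<And>i. i \<in> I \<Longrightarrow> norm (a i) \<le> c" "0 < p" 
  shows "norm (\<Sum>i\<in>I. a i * z i) powr p \<le> (real (card I) * c) powr p * (\<Sum>i\<in>I. norm (z i) powr p)"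
proof (cases "I = {}")
  case False
  then have c: "0 \<le> c" using assms(2) norm_ge_zero order_trans by blast
  have "norm (\<Sum>i\<in>I. a i * z i) \<le> (\<Sum>i\<in>I. c * norm (z i))"
    by (rule sum_norm_le) (auto simp: norm_mult intro!: mult_right_mono assms(2))
  then have "norm (\<Sum>i\<in>I. a i * z i) powr p \<le> (c * (\<Sum>i\<in>I. norm (z i))) powr p"
    using assms(3) by (intro powr_mono2) (auto simp: sum_distrib_left)
  also have "\<dots> \<le> c powr p * (real (card I) powr p * (\<Sum>i\<in>I. norm (z i) powr p))"
    using c assms by (subst powr_mult) (auto intro!: mult_left_mono powr_sum_le sum_nonneg)
  finally show ?thesis using c by (simp add: powr_mult mult_ac)
qed (simp)

section \<open>Integrals of powers and moduli of smoothness\<close>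

text \<open>The \<open>p\<close>-th power of the \<open>L\<^sup>p\<close> quasi-norm. For every \<open>p > 0\<close> it satisfies a triangle
  inequality up to a constant and it can be exchanged with other integrals, so the estimates are made
  at this level and the root is taken at the end.\<close>

definition power_integral :: "real \<Rightarrow> ('a::euclidean_space \<Rightarrow> complex) \<Rightarrow> ennreal" where
  "power_integral p f = (\<integral>\<^sup>+x. ennreal (norm (f x) powr p) \<partial>lborel)"

lemma Lp_qnorm_eq: "Lp_qnorm (ereal p) f = enn_powr (power_integral p f) (1 / p)"
  by (simp add: Lp_qnorm_def power_integral_def nn_integral_completion)

lemma Lp_qnorm_powr: "0 < p \<Longrightarrow> enn_powr (Lp_qnorm (ereal p) f) p = power_integral p f"
  by (simp add: Lp_qnorm_eq enn_powr_powr)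

lemma nn_integral_lborel_translate:
  fixes f :: "'a::euclidean_space \<Rightarrow> ennreal"
  assumes "f \<in> borel_measurable borel"
  shows "(\<integral>\<^sup>+x. f (c + x) \<partial>lborel) = (\<integral>\<^sup>+x. f x \<partial>lborel)"
proof -
  have "(\<integral>\<^sup>+x. f x \<partial>lborel) = (\<integral>\<^sup>+x. f x \<partial>distr lborel borel ((+) c))"
    by (simp add: lborel_distr_plus)
  also have "\<dots> = (\<integral>\<^sup>+x. f (c + x) \<partial>lborel)"
    using assms by (intro nn_integral_distr) auto
  finally show ?thesis by simp
qed

lemma power_integral_translate:
  fixes f :: "'a::euclidean_space \<Rightarrow> complex"
  assumes [measurable]: "f \<in> borel_measurable borel"
  shows "power_integral p (\<lambda>x. f (x + c)) = power_integral p f"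
  unfolding power_integral_def
  using nn_integral_lborel_translate[of "\<lambda>x. ennreal (norm (f x) powr p)" c]
  by (simp add: add.commute)

lemma power_integral_sum_le:
  fixes g :: "'i \<Rightarrow> 'a::euclidean_space \<Rightarrow> complex"
  assumes "finite I" "\<And>i. i \<in> I \<Longrightarrow> norm (a i) \<le> c" "0 < p"
    and [measurable]: "\<And>i. i \<in> I \<Longrightarrow> g i \<in> borel_measurable borel"
  shows "power_integral p (\<lambda>x. \<Sum>i\<in>I. a i * g i x)
    \<le> ennreal ((real (card I) * c) powr p) * (\<Sum>i\<in>I. power_integral p (g i))"
proof -
  have "power_integral p (\<lambda>x. \<Sum>i\<in>I. a i * g i x) \<le>
     (\<integral>\<^sup>+x. ennreal ((real (card I) * c) powr p) * (\<Sum>i\<in>I. ennreal (norm (g i x) powr p)) \<partial>lborel)"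
    unfolding power_integral_def
    by (intro nn_integral_mono, subst sum_ennreal, simp, subst ennreal_mult[symmetric])
       (auto intro!: ennreal_leI norm_powr_sum_le sum_nonneg assms)
  also have "\<dots> = ennreal ((real (card I) * c) powr p) * (\<Sum>i\<in>I. power_integral p (g i))"
    unfolding power_integral_def by (subst nn_integral_cmult) (auto simp: nn_integral_sum simp del: sum_ennreal)
  finally show ?thesis .
qed

lemma measurable_power_integral [measurable (raw)]:
  fixes G :: "'z \<Rightarrow> 'a::euclidean_space \<Rightarrow> complex"
  assumes [measurable]: "case_prod G \<in> borel_measurable (N \<Otimes>\<^sub>M lborel)"
  shows "(\<lambda>z. power_integral p (G z)) \<in> borel_measurable N"
  unfolding power_integral_def by measurable

text \<open>The constant for a combination of \<open>M + 1\<close> translates with coefficients at most \<open>2\<^sup>M\<close>, the bound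
  for binomial coefficients.\<close>

definition diff_const :: "nat \<Rightarrow> real \<Rightarrow> real" where
  "diff_const M p = (real (Suc M) * 2 ^ M) powr p * real (Suc M)"

lemma diff_const_pos: "0 < diff_const M p"
  by (simp add: diff_const_def)

lemma binomial_le_power2: "n choose k \<le> 2 ^ n"
proof (cases "k \<le> n")
  case True
  then have "n choose k \<le> (\<Sum>i\<le>n. n choose i)" by (intro member_le_sum[where f = "binomial n"]) auto
  then show ?thesis by (simp add: choose_row_sum)
qed (simp add: binomial_eq_0)

lemma norm_binomial_le: "norm (of_nat (n choose k) :: complex) \<le> 2 ^ n"
proof -
  have "real (n choose k) \<le> real (2 ^ n)"
    by (rule of_nat_mono[OF binomial_le_power2])
  then show ?thesis by simp
qed

text \<open>The difference with the doubled step is a combination of \<open>M + 1\<close> translates of the original one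
  with coefficients at most \<open>2\<^sup>M\<close>, and translates have the same \<open>L\<^sup>p\<close> quasi-norm.\<close>

lemma power_integral_fdiff_double_le:
  fixes f :: "'a::euclidean_space \<Rightarrow> complex"
  assumes [measurable]: "f \<in> borel_measurable borel" and p: "0 < p"
  shows "power_integral p (fdiff M (2 *\<^sub>R h) f) \<le> ennreal (diff_const M p) * power_integral p (fdiff M h f)"
proof -
  have "power_integral p (fdiff M (2 *\<^sub>R h) f)
     = power_integral p (\<lambda>x. \<Sum>i\<le>M. of_nat (M choose i) * fdiff M h f (x + real i *\<^sub>R h))"
    by (simp add: fdiff_double[abs_def])
  also have "\<dots> \<le> ennreal ((real (card {..M}) * 2 ^ M) powr p)
      * (\<Sum>i\<le>M. power_integral p (\<lambda>x. fdiff M h f (x + real i *\<^sub>R h)))"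
    using p norm_binomial_le by (intro power_integral_sum_le) (auto simp del: norm_of_nat)
  also have "\<dots> = ennreal (diff_const M p) * power_integral p (fdiff M h f)"
    by (simp add: power_integral_translate diff_const_def ennreal_mult mult.assoc
        del: of_nat_Suc flip: ennreal_of_nat_eq_real_of_nat)
  finally show ?thesis .
qed

lemma Lp_modulus_mono: "t \<le> t' \<Longrightarrow> Lp_modulus M p f t \<le> Lp_modulus M p f t'"
  unfolding Lp_modulus_def by (intro SUP_subset_mono) auto

lemma Lp_modulus_leI:
  assumes "0 < p" "\<And>h. norm h \<le> t \<Longrightarrow> power_integral p (fdiff M h f) \<le> B"
  shows "Lp_modulus M (ereal p) f t \<le> enn_powr B (1 / p)"
  unfolding Lp_modulus_def Lp_qnorm_eq using assms by (intro SUP_least enn_powr_mono) auto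

lemma power_integral_fdiff_le_modulus:
  assumes "0 < p" "norm h \<le> t"
  shows "power_integral p (fdiff M h f) \<le> enn_powr (Lp_modulus M (ereal p) f t) p"
  unfolding Lp_qnorm_powr[OF assms(1), symmetric] Lp_modulus_def
  using assms by (intro enn_powr_mono SUP_upper) auto

lemma Lp_modulus_double:
  fixes f :: "'a::euclidean_space \<Rightarrow> complex"
  assumes f: "f \<in> borel_measurable borel" and p: "0 < p"
  shows "Lp_modulus M (ereal p) f (2 * t)
    \<le> ennreal (diff_const M p powr (1 / p)) * Lp_modulus M (ereal p) f t"
proof -
  have "Lp_modulus M (ereal p) f (2 * t)
      \<le> enn_powr (ennreal (diff_const M p) * enn_powr (Lp_modulus M (ereal p) f t) p) (1 / p)"
  proof (rule Lp_modulus_leI[OF p])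
    fix h :: 'a
    assume h: "norm h \<le> 2 * t"
    have "power_integral p (fdiff M (2 *\<^sub>R (h /\<^sub>R 2)) f)
        \<le> ennreal (diff_const M p) * power_integral p (fdiff M (h /\<^sub>R 2) f)"
      by (rule power_integral_fdiff_double_le[OF f p])
    also have "\<dots> \<le> ennreal (diff_const M p) * enn_powr (Lp_modulus M (ereal p) f t) p"
      using h by (intro mult_left_mono power_integral_fdiff_le_modulus[OF p]) auto
    finally show "power_integral p (fdiff M h f) \<le> ennreal (diff_const M p) * enn_powr (Lp_modulus M (ereal p) f t) p"
      by simp
  qed
  then show ?thesis using p by (simp add: enn_powr_cmult diff_const_pos enn_powr_powr)
qed

lemma Lp_modulus_double_iter:
  fixes f :: "'a::euclidean_space \<Rightarrow> complex"
  assumes f: "f \<in> borel_measurable borel" and p: "0 < p"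
  shows "Lp_modulus M (ereal p) f (2 ^ k * t)
    \<le> ennreal ((diff_const M p powr (1 / p)) ^ k) * Lp_modulus M (ereal p) f t"
proof (induction k)
  case (Suc k)
  have "Lp_modulus M (ereal p) f (2 ^ Suc k * t)
      \<le> ennreal (diff_const M p powr (1 / p)) * Lp_modulus M (ereal p) f (2 ^ k * t)"
    using Lp_modulus_double[OF f p, of M "2 ^ k * t"] by (simp add: mult.assoc)
  also have "\<dots> \<le> ennreal (diff_const M p powr (1 / p))
      * (ennreal ((diff_const M p powr (1 / p)) ^ k) * Lp_modulus M (ereal p) f t)"
    by (intro mult_left_mono Suc.IH) simp
  finally show ?case by (simp add: ennreal_mult mult.assoc)
qed simp

section \<open>Replacing the supremum over the steps by an average\<close>

lemma power_integral_fdiff_free_step: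
  fixes g :: "'a::euclidean_space \<Rightarrow> complex"
  assumes [measurable]: "g \<in> borel_measurable borel" and "0 < M" "0 < p"
  shows "power_integral p (fdiff M h g) \<le> ennreal (2 powr p * (real M * 2 ^ M) powr p)
    * (\<Sum>j\<in>{1..M}. power_integral p (fdiff M (real j *\<^sub>R u) g)
                  + power_integral p (fdiff M (h + real j *\<^sub>R u) g))"
proof -
  define P where "P j x = fdiff M (real j *\<^sub>R u) g (x + real j *\<^sub>R h)" for j x
  define Q where "Q j x = fdiff M (h + real j *\<^sub>R u) g x" for j x
  have [measurable]: "P j \<in> borel_measurable borel" "Q j \<in> borel_measurable borel" for j
    unfolding P_def Q_def by measurable
  have shift: "power_integral p (P j) = power_integral p (fdiff M (real j *\<^sub>R u) g)" for j
    unfolding P_def by (rule power_integral_translate) measurable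
  have two: "power_integral p (\<lambda>x. P j x - Q j x)
      \<le> ennreal (2 powr p) * (power_integral p (P j) + power_integral p (Q j))" for j
    using power_integral_sum_le[of "UNIV :: bool set" "\<lambda>b. if b then 1 else - 1" 1 p
        "\<lambda>b. if b then P j else Q j"] assms(3)
    by (simp add: UNIV_bool add.commute)
  have "power_integral p (fdiff M h g)
      = power_integral p (\<lambda>x. \<Sum>j\<in>{1..M}. (- 1) ^ j * of_nat (M choose j) * (P j x - Q j x))"
    unfolding P_def Q_def
    by (rule arg_cong[where f = "power_integral p"], rule ext, rule fdiff_free_step[OF assms(2)])
  also have "\<dots> \<le> ennreal ((real (card {1..M}) * 2 ^ M) powr p)
      * (\<Sum>j\<in>{1..M}. power_integral p (\<lambda>x. P j x - Q j x))"
    using assms(3) norm_binomial_le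
    by (intro power_integral_sum_le) (auto simp: norm_mult norm_power simp del: norm_of_nat)
  also have "\<dots> \<le> ennreal ((real M * 2 ^ M) powr p)
      * (\<Sum>j\<in>{1..M}. ennreal (2 powr p) * (power_integral p (P j) + power_integral p (Q j)))"
    using two by (intro mult_mono sum_mono) auto
  also have "\<dots> = ennreal (2 powr p * (real M * 2 ^ M) powr p)
      * (\<Sum>j\<in>{1..M}. power_integral p (P j) + power_integral p (Q j))"
    by (simp add: sum_distrib_left[symmetric] ennreal_mult mult_ac)
  finally show ?thesis by (simp add: shift Q_def[abs_def])
qed

lemma measurable_indicator_cball [measurable (raw)]:
  fixes g :: "'z \<Rightarrow> 'a::euclidean_space"
  assumes "g \<in> borel_measurable N"
  shows "(\<lambda>x. indicator (cball a r) (g x) :: ennreal) \<in> borel_measurable N"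
  by (rule measurable_compose[OF assms borel_measurable_indicator]) simp

text \<open>The factor of the preceding lemma, doubled because the two kinds of differences in it give the
  same contribution after averaging.\<close>

definition avg_const :: "nat \<Rightarrow> real \<Rightarrow> real" where
  "avg_const M p = 2 * (2 powr p * (real M * 2 ^ M) powr p)"

text \<open>Integrate the preceding estimate over \<open>u\<close> in the ball of radius \<open>t\<close>. In the terms with step
  \<open>h + j u\<close> the dependence on \<open>h\<close> is removed by the translation \<open>w = u + h / j\<close>, which moves the
  ball into the one of radius \<open>2 t\<close>. The right-hand side thus bounds all steps of length at most
  \<open>t\<close> at once.\<close>

lemma power_integral_fdiff_average:
  fixes g :: "'a::euclidean_space \<Rightarrow> complex"
  assumes [measurable]: "g \<in> borel_measurable borel" and "0 < M" "0 < p" and h: "norm h \<le> t"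
  shows "emeasure lborel (cball (0::'a) t) * power_integral p (fdiff M h g) \<le> ennreal (avg_const M p)
    * (\<Sum>j\<in>{1..M}. \<integral>\<^sup>+w\<in>cball 0 (2 * t). power_integral p (fdiff M (real j *\<^sub>R w) g) \<partial>lborel)"
proof -
  define J where "J v = power_integral p (fdiff M v g)" for v
  have [measurable]: "J \<in> borel_measurable borel"
    unfolding J_def by measurable
  define I where "I j = (\<integral>\<^sup>+w\<in>cball 0 (2 * t). J (real j *\<^sub>R w) \<partial>lborel)" for j
  have t: "0 \<le> t" using h norm_ge_zero order_trans by blast
  define c where "c = 2 powr p * (real M * 2 ^ M) powr p"
  have A: "(\<integral>\<^sup>+u\<in>cball 0 t. J (real j *\<^sub>R u) \<partial>lborel) \<le> I j" for j
    unfolding I_def using t by (intro nn_integral_mono) (auto split: split_indicator)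
  have B: "(\<integral>\<^sup>+u\<in>cball 0 t. J (h + real j *\<^sub>R u) \<partial>lborel) \<le> I j" if j: "j \<in> {1..M}" for j
  proof -
    define e where "e = h /\<^sub>R real j"
    have je: "real j *\<^sub>R e = h" using j by (simp add: e_def)
    have "norm e \<le> norm h * 1"
      unfolding e_def norm_scaleR using j
      by (subst mult.commute) (intro mult_left_mono, auto simp: divide_simps)
    then have e: "norm e \<le> t" using h by simp
    have "(\<integral>\<^sup>+u\<in>cball 0 t. J (h + real j *\<^sub>R u) \<partial>lborel)
        = (\<integral>\<^sup>+u. (\<lambda>w. J (real j *\<^sub>R w) * indicator (cball 0 t) (w - e)) (e + u) \<partial>lborel)"
      by (simp add: scaleR_add_right je)
    also have "\<dots> = (\<integral>\<^sup>+w. J (real j *\<^sub>R w) * indicator (cball 0 t) (w - e) \<partial>lborel)"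
      by (rule nn_integral_lborel_translate) measurable
    also have "\<dots> \<le> I j"
      unfolding I_def
    proof (intro nn_integral_mono mult_left_mono)
      fix w :: 'a
      have "norm w \<le> norm (w - e) + norm e" by (metis diff_add_cancel norm_triangle_ineq)
      then show "indicator (cball 0 t) (w - e) \<le> (indicator (cball 0 (2 * t)) w :: ennreal)"
        using e by (auto split: split_indicator)
    qed simp
    finally show ?thesis .
  qed
  have "emeasure lborel (cball (0::'a) t) * J h = (\<integral>\<^sup>+u. J h * indicator (cball 0 t) u \<partial>(lborel :: 'a measure))"
    by (subst nn_integral_cmult_indicator) (auto simp: mult.commute)
  also have "\<dots> \<le> (\<integral>\<^sup>+u. (ennreal c * (\<Sum>j\<in>{1..M}. J (real j *\<^sub>R u) + J (h + real j *\<^sub>R u)))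
      * indicator (cball 0 t) u \<partial>lborel)"
    unfolding J_def c_def
    by (intro nn_integral_mono mult_right_mono power_integral_fdiff_free_step) (use assms in auto)
  also have "\<dots> = (\<integral>\<^sup>+u. ennreal c * (\<Sum>j\<in>{1..M}. J (real j *\<^sub>R u) * indicator (cball 0 t) u
      + J (h + real j *\<^sub>R u) * indicator (cball 0 t) u) \<partial>lborel)"
    by (simp add: sum_distrib_right mult.assoc distrib_right)
  also have "\<dots> = ennreal c * (\<Sum>j\<in>{1..M}. (\<integral>\<^sup>+u\<in>cball 0 t. J (real j *\<^sub>R u) \<partial>lborel)
      + (\<integral>\<^sup>+u\<in>cball 0 t. J (h + real j *\<^sub>R u) \<partial>lborel))"
    by (simp add: nn_integral_cmult nn_integral_sum nn_integral_add)
  also have "\<dots> \<le> ennreal c * (\<Sum>j\<in>{1..M}. I j + I j)"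
    using A B by (intro mult_left_mono sum_mono add_mono) auto
  also have "\<dots> = ennreal c * (2 * (\<Sum>j\<in>{1..M}. I j))"
    by (simp add: sum.distrib mult_2)
  also have "\<dots> = ennreal (avg_const M p) * (\<Sum>j\<in>{1..M}. I j)"
    by (simp add: avg_const_def c_def ennreal_mult mult_ac)
  finally show ?thesis by (simp add: J_def I_def)
qed

section \<open>Moduli of smoothness of the slices\<close>

lemma power_integral_slices:
  fixes f :: "'a::euclidean_space \<times> 'b::euclidean_space \<Rightarrow> complex"
  assumes [measurable]: "f \<in> borel_measurable borel"
  shows "(\<integral>\<^sup>+y. power_integral p (\<lambda>x. f (x, y)) \<partial>lborel) = power_integral p f"
proof -
  have "(\<lambda>z. ennreal (norm (f z) powr p)) \<in> borel_measurable (lborel \<Otimes>\<^sub>M lborel)"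
    unfolding lborel_prod by simp
  from lborel_pair.nn_integral_snd[OF this] show ?thesis
    unfolding power_integral_def lborel_prod .
qed

text \<open>A Borel measurable majorant, as a function of \<open>y\<close>, of the \<open>p\<close>-th power of the modulus of the
  slice at \<open>y\<close>. The modulus itself is a supremum over uncountably many steps, which cannot be exchanged with
  the integral over \<open>y\<close>; the average can.\<close>

definition slice_average ::
  "nat \<Rightarrow> real \<Rightarrow> real \<Rightarrow> ('a::euclidean_space \<times> 'b::euclidean_space \<Rightarrow> complex) \<Rightarrow> 'b \<Rightarrow> ennreal"
where
  "slice_average M p t f y =
     ennreal (avg_const M p / measure lborel (cball (0::'a) t)) *
     (\<Sum>j\<in>{1..M}. \<integral>\<^sup>+w\<in>cball 0 (2 * t). power_integral p (fdiff M (real j *\<^sub>R w) (\<lambda>x. f (x, y))) \<partial>lborel)"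

lemma Lp_modulus_slice_le:
  fixes f :: "'a::euclidean_space \<times> 'b::euclidean_space \<Rightarrow> complex"
  assumes [measurable]: "f \<in> borel_measurable borel" and "0 < M" "0 < p" "0 < t"
  shows "Lp_modulus M (ereal p) (\<lambda>x. f (x, y)) t \<le> enn_powr (slice_average M p t f y) (1 / p)"
proof (rule Lp_modulus_leI[OF \<open>0 < p\<close>])
  fix h :: 'a
  assume h: "norm h \<le> t"
  let ?g = "\<lambda>x. f (x, y)"
  let ?v = "measure lborel (cball (0::'a) t)"
  define S where "S = (\<Sum>j\<in>{1..M}. \<integral>\<^sup>+w\<in>cball 0 (2 * t). power_integral p (fdiff M (real j *\<^sub>R w) ?g) \<partial>lborel)"
  have v: "0 < ?v" using \<open>0 < t\<close> by (simp add: content_cball_pos)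
  have e: "emeasure lborel (cball (0::'a) t) = ennreal ?v"
    by (intro emeasure_eq_ennreal_measure) (use emeasure_bounded_finite[of "cball (0::'a) t"] in auto)
  have "power_integral p (fdiff M h ?g) = ennreal (1 / ?v) * (ennreal ?v * power_integral p (fdiff M h ?g))"
    using v by (simp flip: mult.assoc ennreal_mult)
  also have "\<dots> \<le> ennreal (1 / ?v) * (ennreal (avg_const M p) * S)"
    unfolding e[symmetric] S_def
    by (intro mult_left_mono power_integral_fdiff_average) (use h assms in auto)
  also have "\<dots> = slice_average M p t f y"
    using v by (simp add: slice_average_def S_def avg_const_def flip: mult.assoc ennreal_mult)
  finally show "power_integral p (fdiff M h ?g) \<le> slice_average M p t f y" .
qed

lemma measurable_fdiff_slice [measurable (raw)]:
  fixes f :: "'a::euclidean_space \<times> 'b::euclidean_space \<Rightarrow> complex"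
  assumes [measurable]: "f \<in> borel_measurable borel"
    and [measurable]: "h \<in> borel_measurable N" "k \<in> borel_measurable N" "g \<in> borel_measurable N"
  shows "(\<lambda>z. fdiff M (h z) (\<lambda>x. f (x, k z)) (g z)) \<in> borel_measurable N"
proof -
  have "(\<lambda>z. fdiff M (h z, 0) f (g z, k z)) \<in> borel_measurable N" by measurable
  then show ?thesis by (simp add: fdiff_slice)
qed

lemma measurable_power_integral_fdiff_slice [measurable (raw)]:
  fixes f :: "'a::euclidean_space \<times> 'b::euclidean_space \<Rightarrow> complex"
  assumes [measurable]: "f \<in> borel_measurable borel"
    and [measurable]: "h \<in> borel_measurable N" "k \<in> borel_measurable N"
  shows "(\<lambda>z. power_integral p (fdiff M (h z) (\<lambda>x. f (x, k z)))) \<in> borel_measurable N"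
  by (intro measurable_power_integral)
     (unfold case_prod_beta, intro measurable_fdiff_slice, auto)

lemma measurable_slice_average [measurable]:
  fixes f :: "'a::euclidean_space \<times> 'b::euclidean_space \<Rightarrow> complex"
  assumes [measurable]: "f \<in> borel_measurable borel"
  shows "slice_average M p t f \<in> borel_measurable borel"
  unfolding slice_average_def[abs_def] by measurable

text \<open>By Tonelli, the integral over the slices of the power integral of a difference in the
  \<open>x\<close>-direction is the power integral of a difference of \<open>f\<close> with step \<open>(j w, 0)\<close>. Its length is
  at most \<open>2 M t\<close>, which is rounded up to a power of two times \<open>t\<close> in order to use doubling
  afterwards. The power of two in the constant is the ratio of the volumes of the balls of radius \<open>2 t\<close> and \<open>t\<close>.\<close>

lemma slice_average_integral_le:
  fixes f :: "'a::euclidean_space \<times> 'b::euclidean_space \<Rightarrow> complex"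
  assumes [measurable]: "f \<in> borel_measurable borel" and "0 < p" "0 < t"
  shows "(\<integral>\<^sup>+y. slice_average M p t f y \<partial>lborel)
    \<le> ennreal (avg_const M p * 2 ^ DIM('a) * real M)
        * enn_powr (Lp_modulus M (ereal p) f (2 ^ (2 * M) * t)) p"
proof -
  let ?v = "measure lborel (cball (0::'a) t)"
  define W where "W = enn_powr (Lp_modulus M (ereal p) f (2 ^ (2 * M) * t)) p"
  have v: "0 < ?v" using \<open>0 < t\<close> by (simp add: content_cball_pos)
  have e: "emeasure lborel (cball (0::'a) (2 * t)) = ennreal (2 ^ DIM('a) * ?v)"
    using \<open>0 < t\<close> by (simp add: emeasure_cball content_cball power_mult_distrib mult_ac)
  have nn: "0 \<le> avg_const M p / ?v" "0 \<le> 2 ^ DIM('a) * ?v"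
    using v by (auto simp: avg_const_def)
  have T: "(\<integral>\<^sup>+y. (\<integral>\<^sup>+w\<in>cball 0 (2 * t). power_integral p (fdiff M (real j *\<^sub>R w) (\<lambda>x. f (x, y))) \<partial>lborel) \<partial>lborel)
      \<le> W * ennreal (2 ^ DIM('a) * ?v)" if j: "j \<in> {1..M}" for j
  proof -
    have "(\<integral>\<^sup>+y. (\<integral>\<^sup>+w\<in>cball (0::'a) (2 * t). power_integral p (fdiff M (real j *\<^sub>R w) (\<lambda>x. f (x, y))) \<partial>lborel) \<partial>lborel)
       = (\<integral>\<^sup>+w. (\<integral>\<^sup>+y. power_integral p (fdiff M (real j *\<^sub>R w) (\<lambda>x. f (x, y))) * indicator (cball 0 (2 * t)) w \<partial>lborel) \<partial>lborel)"
      by (rule lborel_pair.Fubini') measurable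
    also have "\<dots> = (\<integral>\<^sup>+w. power_integral p (fdiff M (real j *\<^sub>R w, 0) f) * indicator (cball 0 (2 * t)) w \<partial>lborel)"
    proof (intro nn_integral_cong)
      fix w :: 'a
      have "(\<integral>\<^sup>+y. power_integral p (fdiff M (real j *\<^sub>R w) (\<lambda>x. f (x, y))) \<partial>lborel)
         = (\<integral>\<^sup>+y. power_integral p (\<lambda>x. fdiff M (real j *\<^sub>R w, 0) f (x, y)) \<partial>lborel)"
        by (simp add: fdiff_slice[abs_def])
      also have "\<dots> = power_integral p (fdiff M (real j *\<^sub>R w, 0) f)"
        by (rule power_integral_slices) measurable
      finally show "(\<integral>\<^sup>+y. power_integral p (fdiff M (real j *\<^sub>R w) (\<lambda>x. f (x, y)))
          * indicator (cball 0 (2 * t)) w \<partial>lborel)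
          = power_integral p (fdiff M (real j *\<^sub>R w, 0) f) * indicator (cball 0 (2 * t)) w"
        by (subst nn_integral_multc) auto
    qed
    also have "\<dots> \<le> (\<integral>\<^sup>+w. W * indicator (cball (0::'a) (2 * t)) w \<partial>lborel)"
    proof (intro nn_integral_mono)
      fix w :: 'a
      have "power_integral p (fdiff M (real j *\<^sub>R w, 0) f) \<le> W" if w: "norm w \<le> 2 * t"
        unfolding W_def
      proof (rule power_integral_fdiff_le_modulus[OF \<open>0 < p\<close>])
        have "norm (real j *\<^sub>R w, 0 :: 'b) \<le> real M * (2 * t)"
          using j w by (simp add: norm_Pair) (intro mult_mono, auto)
        also have "\<dots> \<le> real (2 * M) * t" by simp
        also have "\<dots> \<le> 2 ^ (2 * M) * t"
          using \<open>0 < t\<close> of_nat_less_two_power[of "2 * M", where ?'a = real]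
          by (intro mult_right_mono) auto
        finally show "norm (real j *\<^sub>R w, 0 :: 'b) \<le> 2 ^ (2 * M) * t" .
      qed
      then show "power_integral p (fdiff M (real j *\<^sub>R w, 0) f) * indicator (cball 0 (2 * t)) w
          \<le> W * indicator (cball 0 (2 * t)) w"
        by (auto split: split_indicator)
    qed
    also have "\<dots> = W * ennreal (2 ^ DIM('a) * ?v)"
      by (simp add: nn_integral_cmult_indicator e)
    finally show ?thesis .
  qed
  have "(\<integral>\<^sup>+y. slice_average M p t f y \<partial>lborel) = ennreal (avg_const M p / ?v) *
     (\<Sum>j\<in>{1..M}. \<integral>\<^sup>+y. (\<integral>\<^sup>+w\<in>cball 0 (2 * t). power_integral p (fdiff M (real j *\<^sub>R w) (\<lambda>x. f (x, y))) \<partial>lborel) \<partial>lborel)"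
    unfolding slice_average_def by (subst nn_integral_cmult, measurable, subst nn_integral_sum) auto
  also have "\<dots> \<le> ennreal (avg_const M p / ?v) * (\<Sum>j\<in>{1..M}. W * ennreal (2 ^ DIM('a) * ?v))"
    using T by (intro mult_left_mono sum_mono) auto
  also have "\<dots> = ennreal (avg_const M p / ?v) * ennreal (real M) * ennreal (2 ^ DIM('a) * ?v) * W"
    by (simp add: mult_ac ennreal_of_nat_eq_real_of_nat)
  also have "ennreal (avg_const M p / ?v) * ennreal (real M) * ennreal (2 ^ DIM('a) * ?v)
      = ennreal (avg_const M p / ?v * real M * (2 ^ DIM('a) * ?v))"
    using nn by (simp only: ennreal_mult mult_nonneg_nonneg of_nat_0_le_iff)
  also have "avg_const M p / ?v * real M * (2 ^ DIM('a) * ?v) = avg_const M p * 2 ^ DIM('a) * real M"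
    using v by simp
  finally show ?thesis by (simp add: W_def)
qed

text \<open>Doubling absorbs the dilation of the argument of the modulus.\<close>

lemma slice_average_integral_le_modulus:
  assumes "0 < p"
  shows "\<exists>C>0. \<forall>(f :: 'a::euclidean_space \<times> 'b::euclidean_space \<Rightarrow> complex) t.
    f \<in> borel_measurable borel \<longrightarrow> 0 < t \<longrightarrow>
    (\<integral>\<^sup>+y. slice_average M p t f y \<partial>lborel) \<le> enn_powr (ennreal C * Lp_modulus M (ereal p) f t) p"
proof -
  define D where "D = (diff_const M p powr (1 / p)) ^ (2 * M)"
  \<comment> \<open>The summand 1 keeps the constant positive for every \<open>M\<close>.\<close>
  define A where "A = avg_const M p * 2 ^ DIM('a) * real M + 1"
  have "0 \<le> avg_const M p" by (simp add: avg_const_def)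
  then have pos: "0 < D" "0 < A"
    using diff_const_pos[of M p] unfolding D_def A_def by (auto intro!: add_nonneg_pos)
  show ?thesis
  proof (intro exI[of _ "A powr (1 / p) * D"] conjI allI impI)
    show "0 < A powr (1 / p) * D" using pos by simp
  next
    fix f :: "'a \<times> 'b \<Rightarrow> complex" and t :: real
    assume f: "f \<in> borel_measurable borel" and t: "0 < t"
    have "(\<integral>\<^sup>+y. slice_average M p t f y \<partial>lborel)
       \<le> ennreal (avg_const M p * 2 ^ DIM('a) * real M)
          * enn_powr (Lp_modulus M (ereal p) f (2 ^ (2 * M) * t)) p"
      by (rule slice_average_integral_le[OF f assms t])
    also have "\<dots> \<le> ennreal A * enn_powr (ennreal D * Lp_modulus M (ereal p) f t) p"
      using assms unfolding A_def D_def
      by (intro mult_mono enn_powr_mono Lp_modulus_double_iter[OF f assms] ennreal_leI) auto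
    also have "\<dots> = enn_powr (ennreal (A powr (1 / p) * D) * Lp_modulus M (ereal p) f t) p"
      using pos assms by (simp add: enn_powr_cmult powr_mult powr_powr ennreal_mult mult.assoc)
    finally show "(\<integral>\<^sup>+y. slice_average M p t f y \<partial>lborel)
       \<le> enn_powr (ennreal (A powr (1 / p) * D) * Lp_modulus M (ereal p) f t) p" .
  qed
qed

section \<open>Dyadic discretisation\<close>

definition dyad :: "nat \<Rightarrow> real" where
  "dyad j = 2 powr - real j"

definition dyad_interval :: "nat \<Rightarrow> real set" where
  "dyad_interval j = {dyad (Suc j)<..dyad j}"

lemma dyad_pos: "0 < dyad j"
  by (simp add: dyad_def)

lemma dyad_antimono: "i \<le> j \<Longrightarrow> dyad j \<le> dyad i"
  by (simp add: dyad_def)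

lemma dyad_le_one: "dyad j \<le> 1"
  using dyad_antimono[of 0 j] by (simp add: dyad_def)

lemma dyad_Suc: "dyad j = 2 * dyad (Suc j)"
proof -
  have "2 * dyad (Suc j) = 2 powr (1 + - real (Suc j))"
    unfolding dyad_def by (subst powr_add) simp
  then show ?thesis by (simp add: dyad_def)
qed

lemma dyad_powr: "dyad j powr a = 1 / 2 powr (real j * a)"
proof -
  have "dyad j powr a = 2 powr - (real j * a)" by (simp add: dyad_def powr_powr)
  then show ?thesis by (simp add: powr_minus_divide)
qed

lemma dyad_interval_cover:
  assumes "0 < t" "t \<le> 1"
  shows "\<exists>k. t \<in> dyad_interval k"
proof -
  define k where "k = nat \<lfloor>- log 2 t\<rfloor>"
  have "0 \<le> - log 2 t" using assms by simp
  then have k: "real k \<le> - log 2 t" "- log 2 t < real (Suc k)"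
    unfolding k_def by linarith+
  have "- real (Suc k) < log 2 t" "log 2 t \<le> - real k" using k by linarith+
  then have "2 powr - real (Suc k) < t" "t \<le> 2 powr - real k"
    using assms by (simp_all add: less_log_iff log_le_iff)
  then show ?thesis by (auto simp: dyad_interval_def dyad_def)
qed

lemma dyad_interval_unique:
  assumes "t \<in> dyad_interval j" "t \<in> dyad_interval k"
  shows "j = k"
proof (rule ccontr)
  assume "j \<noteq> k"
  then consider "Suc j \<le> k" | "Suc k \<le> j" by linarith
  then show False
    by cases (use assms dyad_antimono in \<open>fastforce simp: dyad_interval_def\<close>)+
qed

lemma dyad_interval_subset: "dyad_interval j \<subseteq> {0<..1}"
  using dyad_pos[of "Suc j"] dyad_le_one[of j] by (auto simp: dyad_interval_def)

lemma dyad_interval_sets [measurable]: "dyad_interval j \<in> sets borel"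
  by (simp add: dyad_interval_def)

lemma suminf_dyad_interval:
  fixes B :: "nat \<Rightarrow> ennreal"
  assumes "t \<in> dyad_interval k"
  shows "(\<Sum>j. B j * indicator (dyad_interval j) t) = B k"
proof -
  have "(\<Sum>j. B j * indicator (dyad_interval j) t) = (\<Sum>j\<in>{k}. B j * indicator (dyad_interval j) t)"
    using dyad_interval_unique[OF assms] by (intro suminf_finite) (auto split: split_indicator)
  then show ?thesis using assms by simp
qed

lemma nn_integral_dyad_step:
  fixes B :: "nat \<Rightarrow> ennreal"
  shows "(\<integral>\<^sup>+t. (\<Sum>j. B j * indicator (dyad_interval j) t) \<partial>lborel) = (\<Sum>j. B j * ennreal (dyad (Suc j)))"
proof -
  have "(\<integral>\<^sup>+t. (\<Sum>j. B j * indicator (dyad_interval j) t) \<partial>lborel)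
      = (\<Sum>j. \<integral>\<^sup>+t. B j * indicator (dyad_interval j) t \<partial>lborel)"
    by (rule nn_integral_suminf) measurable
  also have "\<dots> = (\<Sum>j. B j * ennreal (dyad (Suc j)))"
    using dyad_antimono
    by (intro suminf_cong, subst nn_integral_cmult_indicator)
       (auto simp: dyad_interval_def, metis add_diff_cancel_right' dyad_Suc mult_2)
  finally show ?thesis .
qed

lemma nn_integral_le_dyadic:
  assumes "\<And>j t. t \<in> dyad_interval j \<Longrightarrow> h t \<le> B j"
  shows "(\<integral>\<^sup>+t\<in>{0<..1}. h t \<partial>lebesgue) \<le> (\<Sum>j. B j * ennreal (dyad (Suc j)))"
  unfolding nn_integral_dyad_step[symmetric] nn_integral_completion
proof (intro nn_integral_mono)
  fix t :: real
  show "h t * indicator {0<..1} t \<le> (\<Sum>j. B j * indicator (dyad_interval j) t)"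
  proof (cases "t \<in> {0<..1}")
    case True
    then obtain k where k: "t \<in> dyad_interval k" using dyad_interval_cover by auto
    then show ?thesis using assms True by (simp add: suminf_dyad_interval)
  qed simp
qed

lemma dyadic_le_nn_integral:
  assumes "\<And>j t. t \<in> dyad_interval j \<Longrightarrow> B j \<le> h t"
  shows "(\<Sum>j. B j * ennreal (dyad (Suc j))) \<le> (\<integral>\<^sup>+t\<in>{0<..1}. h t \<partial>lebesgue)"
  unfolding nn_integral_dyad_step[symmetric] nn_integral_completion
proof (intro nn_integral_mono)
  fix t :: real
  show "(\<Sum>j. B j * indicator (dyad_interval j) t) \<le> h t * indicator {0<..1} t"
  proof (cases "t \<in> {0<..1}")
    case True
    then obtain k where k: "t \<in> dyad_interval k" using dyad_interval_cover by auto
    then show ?thesis using assms True by (simp add: suminf_dyad_interval)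
  next
    case False
    then have "t \<notin> dyad_interval j" for j using dyad_interval_subset by blast
    then show ?thesis by simp
  qed
qed

lemma admissible_pos: "admissible \<Psi> \<Longrightarrow> 0 < \<Psi> (dyad j)"
  using dyad_pos[of j] dyad_le_one[of j] by (auto simp: admissible_def)

lemma admissible_between:
  assumes "admissible \<Psi>" "0 < a" "a \<le> t" "t \<le> b" "b \<le> 1"
  shows "min (\<Psi> a) (\<Psi> b) \<le> \<Psi> t" "\<Psi> t \<le> max (\<Psi> a) (\<Psi> b)"
  using assms unfolding admissible_def monotone_on_def by force+

text \<open>By monotonicity it is enough to compare the values at \<open>2\<^sup>-\<^sup>j\<close> and \<open>2\<^sup>-\<^sup>j\<^sup>-\<^sup>1\<close>. For
  \<open>j \<ge> 1\<close> the second point lies between \<open>2\<^sup>-\<^sup>2\<^sup>j\<close> and \<open>2\<^sup>-\<^sup>j\<close>, where the function is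
  comparable by assumption; for \<open>j = 0\<close> the ratio of the two values is a single positive number.\<close>

lemma admissible_dyadic:
  assumes adm: "admissible \<Psi>"
  shows "\<exists>c C. 0 < c \<and> 0 < C \<and>
    (\<forall>j. \<forall>t\<in>dyad_interval j. c * \<Psi> (dyad j) \<le> \<Psi> t \<and> \<Psi> t \<le> C * \<Psi> (dyad j))"
proof -
  obtain c C where cC: "0 < c" "c \<le> C"
      "\<And>j. c * \<Psi> (dyad (2 * j)) \<le> \<Psi> (dyad j)" "\<And>j. \<Psi> (dyad j) \<le> C * \<Psi> (dyad (2 * j))"
    using adm unfolding admissible_def dyad_def by auto
  define \<rho> where "\<rho> = \<Psi> (dyad 1) / \<Psi> (dyad 0)"
  define c' where "c' = min 1 (min (1 / C) \<rho>)"
  define C' where "C' = max 1 (max (1 / c) \<rho>)"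
  note pos = admissible_pos[OF adm]
  have c': "0 < c'" "c' \<le> 1" "c' \<le> 1 / C" "c' \<le> \<rho>" and C': "1 \<le> C'" "1 / c \<le> C'" "\<rho> \<le> C'"
    using cC pos by (auto simp: c'_def C'_def \<rho>_def)
  have mono: "a * \<Psi> (dyad j) \<le> b * \<Psi> (dyad j)" if "a \<le> b" for a b j
    using that pos[of j] by (intro mult_right_mono) auto
  have step: "c' * \<Psi> (dyad j) \<le> \<Psi> (dyad (Suc j)) \<and> \<Psi> (dyad (Suc j)) \<le> C' * \<Psi> (dyad j)" for j
  proof (cases "j = 0")
    case True
    have "c' * \<Psi> (dyad 0) \<le> \<rho> * \<Psi> (dyad 0)" "\<rho> * \<Psi> (dyad 0) \<le> C' * \<Psi> (dyad 0)"
      using c' C' pos[of 0] by (auto intro!: mult_right_mono)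
    then show ?thesis using True pos[of 0] by (simp add: \<rho>_def)
  next
    case False
    have "dyad (2 * j) \<le> dyad (Suc j)" "dyad (Suc j) \<le> dyad j"
      using False by (auto intro!: dyad_antimono)
    note b = admissible_between[OF adm dyad_pos this dyad_le_one]
    have "\<Psi> (dyad (2 * j)) \<le> 1 / c * \<Psi> (dyad j)" "1 / C * \<Psi> (dyad j) \<le> \<Psi> (dyad (2 * j))"
      using cC(1,2) cC(3,4)[of j] by (auto simp: field_simps)
    moreover note mono[OF C'(2), of j] mono[OF c'(3), of j] mono[OF C'(1), of j] mono[OF c'(2), of j]
    ultimately show ?thesis using b by linarith
  qed
  show ?thesis
  proof (rule exI[of _ c'], rule exI[of _ C'], intro conjI allI ballI)
    show "0 < c'" "0 < C'" using c' C' by auto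
    fix j t
    assume "t \<in> dyad_interval j"
    then have t: "dyad (Suc j) \<le> t" "t \<le> dyad j" by (auto simp: dyad_interval_def)
    note b = admissible_between[OF adm dyad_pos t dyad_le_one]
    show "c' * \<Psi> (dyad j) \<le> \<Psi> t" "\<Psi> t \<le> C' * \<Psi> (dyad j)"
      using b step[of j] mono[OF C'(1), of j] mono[OF c'(2), of j] by linarith+
  qed
qed

text \<open>The weight \<open>2\<^sup>j\<^sup>s \<Psi> (2\<^sup>-\<^sup>j)\<close> of the modulus at \<open>2\<^sup>-\<^sup>j\<close> in the discrete form of the
  Besov seminorm.\<close>

definition dyad_weight :: "real \<Rightarrow> (real \<Rightarrow> real) \<Rightarrow> nat \<Rightarrow> real" where
  "dyad_weight s \<Psi> j = \<Psi> (dyad j) * 2 powr (real j * s)"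

lemma dyad_weight_pos: "admissible \<Psi> \<Longrightarrow> 0 < dyad_weight s \<Psi> j"
  by (simp add: dyad_weight_def admissible_pos)

text \<open>On each dyadic interval the modulus is at most its value at the right end point, and the weights
  are comparable to their values there.\<close>

lemma besov_seminorm_le_dyadic:
  assumes "admissible \<Psi>" "0 < s" "0 < r"
  shows "\<exists>C>0. \<forall>(g :: 'a::euclidean_space \<Rightarrow> complex).
    enn_powr (besov_seminorm M s \<Psi> p (ereal r) g) r
    \<le> ennreal C * (\<Sum>j. ennreal (dyad_weight s \<Psi> j powr r) * enn_powr (Lp_modulus M p g (dyad j)) r)"
proof -
  obtain C where C: "0 < C" "\<And>j t. t \<in> dyad_interval j \<Longrightarrow> \<Psi> t \<le> C * \<Psi> (dyad j)"
    using admissible_dyadic[OF assms(1)] by auto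
  define C' where "C' = C powr r * 2 powr (s * r)"
  show ?thesis
  proof (intro exI[of _ C'] conjI allI)
    show "0 < C'" using C by (simp add: C'_def)
    fix g :: "'a \<Rightarrow> complex"
    let ?w = "\<lambda>t. enn_powr (Lp_modulus M p g t) r"
    define v where "v j = (C * \<Psi> (dyad j)) powr r / dyad (Suc j) powr (1 + s * r)" for j
    have "(\<integral>\<^sup>+t\<in>{0<..1}. (?w t * ennreal (\<Psi> t powr r / t powr (1 + s * r))) \<partial>lebesgue)
        \<le> (\<Sum>j. (?w (dyad j) * ennreal (v j)) * ennreal (dyad (Suc j)))"
    proof (rule nn_integral_le_dyadic)
      fix j t
      assume t: "t \<in> dyad_interval j"
      have "0 < \<Psi> t" using assms(1) t dyad_interval_subset by (force simp: admissible_def)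
      then have "\<Psi> t powr r / t powr (1 + s * r) \<le> v j"
        unfolding v_def using t C dyad_pos[of "Suc j"] assms
        by (intro frac_le powr_mono2) (auto simp: dyad_interval_def)
      then show "?w t * ennreal (\<Psi> t powr r / t powr (1 + s * r)) \<le> ?w (dyad j) * ennreal (v j)"
        using t assms by (intro mult_mono enn_powr_mono Lp_modulus_mono ennreal_leI) (auto simp: dyad_interval_def)
    qed
    also have "\<dots> = (\<Sum>j. ennreal C' * (ennreal (dyad_weight s \<Psi> j powr r) * ?w (dyad j)))"
    proof (intro suminf_cong)
      fix j
      have "v j * dyad (Suc j) = (C * \<Psi> (dyad j)) powr r / dyad (Suc j) powr (s * r)"
        using dyad_pos[of "Suc j"] by (simp add: v_def powr_add)
      also have "\<dots> = (C * \<Psi> (dyad j)) powr r * 2 powr (real (Suc j) * (s * r))"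
        by (simp add: dyad_powr)
      also have "\<dots> = C' * dyad_weight s \<Psi> j powr r"
        using admissible_pos[OF assms(1), of j] C(1)
        by (simp add: C'_def dyad_weight_def powr_mult powr_powr distrib_left powr_add mult_ac)
      finally have "ennreal (v j) * ennreal (dyad (Suc j)) = ennreal C' * ennreal (dyad_weight s \<Psi> j powr r)"
        using dyad_pos[of "Suc j"] by (simp add: C'_def v_def flip: ennreal_mult)
      then show "(?w (dyad j) * ennreal (v j)) * ennreal (dyad (Suc j))
         = ennreal C' * (ennreal (dyad_weight s \<Psi> j powr r) * ?w (dyad j))"
        by (metis mult.assoc mult.commute)
    qed
    finally show "enn_powr (besov_seminorm M s \<Psi> p (ereal r) g) r
        \<le> ennreal C' * (\<Sum>j. ennreal (dyad_weight s \<Psi> j powr r) * ?w (dyad j))"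
      using assms by (simp add: besov_seminorm_def enn_powr_powr)
  qed
qed

text \<open>Here the modulus has to be bounded from below on a dyadic interval, hence by its value at the
  left end point; the doubling inequality moves it back to the right end point.\<close>

lemma dyadic_le_besov_seminorm:
  assumes "admissible \<Phi>" "0 < s" "0 < q" "0 < p"
  shows "\<exists>C>0. \<forall>(f :: 'a::euclidean_space \<Rightarrow> complex). f \<in> borel_measurable borel \<longrightarrow>
    (\<Sum>j. ennreal (dyad_weight s \<Phi> j powr q) * enn_powr (Lp_modulus M (ereal p) f (dyad j)) q)
    \<le> ennreal C * enn_powr (besov_seminorm M s \<Phi> (ereal p) (ereal q) f) q"
proof -
  obtain c where c: "0 < c" "\<And>j t. t \<in> dyad_interval j \<Longrightarrow> c * \<Phi> (dyad j) \<le> \<Phi> t"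
    using admissible_dyadic[OF assms(1)] by auto
  define D where "D = diff_const M p powr (1 / p)"
  have D: "0 < D" using diff_const_pos[of M p] by (simp add: D_def)
  define C' where "C' = D powr q / c powr q * 2"
  show ?thesis
  proof (intro exI[of _ C'] conjI allI impI)
    show C'0: "0 < C'" using c D by (simp add: C'_def)
    fix f :: "'a \<Rightarrow> complex"
    assume f: "f \<in> borel_measurable borel"
    let ?w = "\<lambda>t. enn_powr (Lp_modulus M (ereal p) f t) q"
    define v where "v j = (c * \<Phi> (dyad j)) powr q / dyad j powr (1 + s * q)" for j
    have "(\<Sum>j. ennreal (dyad_weight s \<Phi> j powr q) * ?w (dyad j))
       \<le> (\<Sum>j. ennreal C' * ((?w (dyad (Suc j)) * ennreal (v j)) * ennreal (dyad (Suc j))))"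
    proof (intro suminf_le allI)
      fix j
      have "?w (dyad j) \<le> enn_powr (ennreal D * Lp_modulus M (ereal p) f (dyad (Suc j))) q"
        using assms Lp_modulus_double[OF f \<open>0 < p\<close>, of M "dyad (Suc j)"]
        by (intro enn_powr_mono) (auto simp: D_def dyad_Suc[of j])
      also have "\<dots> = ennreal (D powr q) * ?w (dyad (Suc j))"
        using D by (rule enn_powr_cmult)
      finally have "ennreal (dyad_weight s \<Phi> j powr q) * ?w (dyad j)
          \<le> ennreal (dyad_weight s \<Phi> j powr q) * (ennreal (D powr q) * ?w (dyad (Suc j)))"
        by (intro mult_left_mono) auto
      also have "\<dots> = ennreal (dyad_weight s \<Phi> j powr q * D powr q) * ?w (dyad (Suc j))"
        by (simp add: ennreal_mult mult.assoc)
      also have "dyad_weight s \<Phi> j powr q * D powr q = C' * (v j * dyad (Suc j))"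
      proof -
        have "v j * dyad (Suc j) = (c * \<Phi> (dyad j)) powr q / dyad j powr (s * q) / 2"
          using dyad_pos[of j] dyad_Suc[of j] by (simp add: v_def powr_add)
        also have "\<dots> = (c * \<Phi> (dyad j)) powr q * 2 powr (real j * (s * q)) / 2"
          by (simp add: dyad_powr)
        also have "\<dots> = c powr q * dyad_weight s \<Phi> j powr q / 2"
          using admissible_pos[OF assms(1), of j] c(1)
          by (simp add: dyad_weight_def powr_mult powr_powr mult_ac)
        finally have "dyad_weight s \<Phi> j powr q = 2 / c powr q * (v j * dyad (Suc j))"
          using c(1) by (simp add: field_simps)
        then show ?thesis by (simp add: C'_def)
      qed
      also have "ennreal (C' * (v j * dyad (Suc j))) * ?w (dyad (Suc j))
          = ennreal C' * ((?w (dyad (Suc j)) * ennreal (v j)) * ennreal (dyad (Suc j)))"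
      proof -
        have "0 \<le> v j" by (simp add: v_def)
        then have "ennreal (C' * (v j * dyad (Suc j))) = ennreal C' * (ennreal (v j) * ennreal (dyad (Suc j)))"
          using C'0 dyad_pos[of "Suc j"]
          by (simp only: ennreal_mult mult_nonneg_nonneg less_imp_le)
        then show ?thesis by (simp only: mult_ac)
      qed
      finally show "ennreal (dyad_weight s \<Phi> j powr q) * ?w (dyad j)
          \<le> ennreal C' * ((?w (dyad (Suc j)) * ennreal (v j)) * ennreal (dyad (Suc j)))" .
    qed auto
    also have "\<dots> = ennreal C' * (\<Sum>j. (?w (dyad (Suc j)) * ennreal (v j)) * ennreal (dyad (Suc j)))"
      by simp
    also have "\<dots> \<le> ennreal C' *
       (\<integral>\<^sup>+t\<in>{0<..1}. (?w t * ennreal (\<Phi> t powr q / t powr (1 + s * q))) \<partial>lebesgue)"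
    proof (intro mult_left_mono dyadic_le_nn_integral)
      fix j t
      assume t: "t \<in> dyad_interval j"
      have "0 < \<Phi> (dyad j)" "0 < t"
        using admissible_pos[OF assms(1)] t dyad_interval_subset[of j] by auto
      then have "v j \<le> \<Phi> t powr q / t powr (1 + s * q)"
        unfolding v_def using t c dyad_pos[of "Suc j"] assms
        by (intro frac_le powr_mono2) (auto simp: dyad_interval_def)
      then show "?w (dyad (Suc j)) * ennreal (v j) \<le> ?w t * ennreal (\<Phi> t powr q / t powr (1 + s * q))"
        using t assms by (intro mult_mono enn_powr_mono Lp_modulus_mono ennreal_leI) (auto simp: dyad_interval_def)
    qed simp
    finally show "(\<Sum>j. ennreal (dyad_weight s \<Phi> j powr q) * ?w (dyad j))
        \<le> ennreal C' * enn_powr (besov_seminorm M s \<Phi> (ereal p) (ereal q) f) q"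
      using assms by (simp add: besov_seminorm_def enn_powr_powr)
  qed
qed

lemma dyadic_le_besov_seminorm_infinity:
  assumes "admissible \<Phi>"
  shows "ennreal (dyad_weight s \<Phi> j) * Lp_modulus M p f (dyad j) \<le> besov_seminorm M s \<Phi> p \<infinity> f"
proof -
  have "ennreal (dyad j powr - s * \<Phi> (dyad j)) * Lp_modulus M p f (dyad j)
      \<le> (SUP t\<in>{0<..1}. ennreal (t powr - s * \<Phi> t) * Lp_modulus M p f t)"
    by (rule SUP_upper) (simp add: dyad_pos dyad_le_one)
  moreover have "dyad j powr - s * \<Phi> (dyad j) = dyad_weight s \<Phi> j"
    by (simp add: dyad_def dyad_weight_def powr_powr)
  ultimately show ?thesis by (simp add: besov_seminorm_def)
qed

section \<open>Two substitutes for the inequality of Hoelder\<close>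

text \<open>A form of Young's inequality that is homogeneous of degree \<open>r\<close> in \<open>(x, \<sigma>)\<close>. Summed over a
  sequence, with \<open>\<sigma>\<close> a bound for the \<open>l\<^sup>q\<close> quasi-norm of the \<open>x\<close>, it does the work of the inequality of
  Hoelder with exponents \<open>q / r\<close> and \<open>q / (q - r)\<close> up to a constant. Comparing \<open>x\<close> with
  \<open>y\<^sup>\<alpha> \<sigma>\<close>, where \<open>\<alpha> = r / (q - r)\<close>, decides which of the two terms on the right is dominant.\<close>

lemma powr_mult_le_Young:
  fixes x y \<sigma> q r :: real
  assumes "0 \<le> x" "0 < y" "0 < \<sigma>" "0 < r" "r < q"
  shows "x powr r * y powr r \<le> x powr q * \<sigma> powr (r - q) + y powr (q * r / (q - r)) * \<sigma> powr r"
proof (cases "x \<le> y powr (r / (q - r)) * \<sigma>")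
  case True
  have "x powr r * y powr r \<le> (y powr (r / (q - r)) * \<sigma>) powr r * y powr r"
    using True assms by (intro mult_right_mono powr_mono2) auto
  also have "\<dots> = y powr (r / (q - r) * r + r) * \<sigma> powr r"
    using assms by (simp add: powr_mult powr_powr powr_add)
  also have "r / (q - r) * r + r = q * r / (q - r)"
    using assms by (simp add: field_simps)
  finally show ?thesis by (simp add: add.commute add_increasing)
next
  case False
  then have x: "0 < x" using assms by (smt (verit) mult_nonneg_nonneg powr_ge_zero)
  have "y powr (r / (q - r)) \<le> x / \<sigma>"
    using False assms by (simp add: field_simps)
  then have "(y powr (r / (q - r))) powr (q - r) \<le> (x / \<sigma>) powr (q - r)"
    using assms by (intro powr_mono2) auto
  moreover have "(y powr (r / (q - r))) powr (q - r) = y powr r"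
    using assms by (simp add: powr_powr)
  moreover have "(x / \<sigma>) powr (q - r) = x powr (q - r) * \<sigma> powr (r - q)"
    using assms powr_minus_divide[of \<sigma> "q - r"] by (simp add: powr_divide)
  ultimately have "y powr r \<le> x powr (q - r) * \<sigma> powr (r - q)" by simp
  then have "x powr r * y powr r \<le> x powr r * (x powr (q - r) * \<sigma> powr (r - q))"
    by (intro mult_left_mono) auto
  also have "\<dots> = x powr q * \<sigma> powr (r - q)"
    by (simp flip: mult.assoc powr_add)
  finally show ?thesis by (simp add: add_increasing2)
qed

lemma enn_powr_mult_le_Young:
  assumes "0 < y" "0 < \<sigma>" "0 < r" "r < q"
  shows "ennreal (y powr r) * enn_powr X r
    \<le> ennreal (\<sigma> powr (r - q)) * enn_powr X q + ennreal (\<sigma> powr r) * ennreal (y powr (q * r / (q - r)))"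
proof (cases X rule: ennreal_cases)
  case (real x)
  then show ?thesis
    using powr_mult_le_Young[of x y \<sigma> r q] assms
    by (simp add: enn_powr_ennreal ennreal_leI mult_ac flip: ennreal_mult ennreal_plus)
qed (use assms in \<open>simp add: ennreal_mult_top\<close>)

text \<open>For \<open>0 < \<theta> \<le> 1\<close> and \<open>b > 0\<close> one has \<open>a\<^sup>\<theta> \<le> b\<^sup>\<theta> (1 + a / b)\<close>; integrate this over \<open>K\<close>
  with \<open>b\<close> the bound for the integral of \<open>A\<close>. It replaces Hoelder's inequality on \<open>K\<close>, with
  \<open>\<theta> = r / p\<close> in the application.\<close>

lemma nn_integral_enn_powr_le:
  assumes [measurable]: "A \<in> borel_measurable M" "K \<in> sets M"
    and K: "emeasure M K = ennreal k" "0 \<le> k"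
    and \<theta>: "0 < \<theta>" "\<theta> \<le> 1" and B: "(\<integral>\<^sup>+y. A y \<partial>M) \<le> B"
  shows "(\<integral>\<^sup>+y\<in>K. enn_powr (A y) \<theta> \<partial>M) \<le> ennreal (1 + k) * enn_powr B \<theta>"
proof (cases B rule: ennreal_cases)
  case (real b)
  show ?thesis
  proof (cases "b = 0")
    case True
    then have "AE y in M. A y = 0"
      using B real by (simp add: nn_integral_0_iff_AE)
    then have "(\<integral>\<^sup>+y\<in>K. enn_powr (A y) \<theta> \<partial>M) = (\<integral>\<^sup>+y. 0 \<partial>M)"
      by (intro nn_integral_cong_AE) (auto elim: eventually_mono)
    then show ?thesis by simp
  next
    case False
    with real have b: "0 < b" by simp
    have "enn_powr (A y) \<theta> \<le> ennreal (b powr \<theta>) * (1 + ennreal (1 / b) * A y)" for y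
    proof (cases "A y" rule: ennreal_cases)
      case (real a)
      have "(a / b) powr \<theta> \<le> 1 + a / b"
      proof (cases "a / b \<le> 1")
        case True
        then have "(a / b) powr \<theta> \<le> 1"
          using \<theta> b real by (intro powr_le1) auto
        then show ?thesis using b real by (simp add: add_increasing2)
      next
        case False
        then have "(a / b) powr \<theta> \<le> (a / b) powr 1" using \<theta> by (intro powr_mono) auto
        then show ?thesis using b real by (simp add: powr_one)
      qed
      then have "b powr \<theta> * (a / b) powr \<theta> \<le> b powr \<theta> * (1 + 1 / b * a)"
        by (intro mult_left_mono) auto
      moreover have "b powr \<theta> * (a / b) powr \<theta> = a powr \<theta>"
        using b real by (simp flip: powr_mult)
      ultimately show ?thesis
        using real b by (simp add: enn_powr_ennreal ennreal_leI flip: ennreal_mult ennreal_1 ennreal_plus del: ennreal_1)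
    qed (use b in \<open>simp add: ennreal_mult_top\<close>)
    then have "(\<integral>\<^sup>+y\<in>K. enn_powr (A y) \<theta> \<partial>M)
        \<le> (\<integral>\<^sup>+y. (ennreal (b powr \<theta>) * (1 + ennreal (1 / b) * A y)) * indicator K y \<partial>M)"
      by (intro nn_integral_mono mult_right_mono) auto
    also have "\<dots> \<le> (\<integral>\<^sup>+y. ennreal (b powr \<theta>) * (indicator K y + ennreal (1 / b) * A y) \<partial>M)"
      by (intro nn_integral_mono) (auto split: split_indicator)
    also have "\<dots> = ennreal (b powr \<theta>) * (ennreal k + ennreal (1 / b) * (\<integral>\<^sup>+y. A y \<partial>M))"
      by (simp add: nn_integral_cmult nn_integral_add K)
    also have "\<dots> \<le> ennreal (b powr \<theta>) * (ennreal k + ennreal (1 / b) * ennreal b)"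
      using B real by (intro mult_left_mono add_left_mono) auto
    also have "\<dots> = ennreal (b powr \<theta> * (k + 1 / b * b))"
      using b K by (simp only: ennreal_mult ennreal_plus mult_nonneg_nonneg add_nonneg_nonneg
          powr_ge_zero less_imp_le divide_nonneg_nonneg zero_le_one)
    also have "b powr \<theta> * (k + 1 / b * b) = (1 + k) * b powr \<theta>"
      using b by (simp add: algebra_simps)
    also have "ennreal \<dots> = ennreal (1 + k) * enn_powr B \<theta>"
      using b K real by (simp only: enn_powr_ennreal ennreal_mult add_nonneg_nonneg zero_le_one powr_ge_zero)
    finally show ?thesis .
  qed
qed (use K in \<open>simp add: ennreal_mult_top\<close>)

section \<open>The weighted dyadic sum of the moduli\<close>

text \<open>The change from \<open>(q, \<Phi>)\<close> to \<open>(r, \<Psi>)\<close>. The weights for \<open>\<Psi>\<close> are those for \<open>\<Phi>\<close> times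
  \<open>y j = \<Psi> (2\<^sup>-\<^sup>j) / \<Phi> (2\<^sup>-\<^sup>j)\<close>, and the summability hypothesis says that \<open>y\<close> is in
  \<open>l\<^sup>\<kappa>\<close>. For \<open>q = \<infinity>\<close> the weighted moduli are bounded by the seminorm and one only sums
  \<open>y\<close>; for finite \<open>q\<close> they are in \<open>l\<^sup>q\<close> and Young's inequality applies.\<close>

lemma dyadic_sum_le_besov_seminorm:
  fixes q :: ereal
  assumes adm: "admissible \<Phi>" "admissible \<Psi>" and s: "0 < s" and p: "0 < p" "ereal p < q"
    and r: "0 < r" "r \<le> p"
    and \<kappa>: "\<kappa> = (if q = \<infinity> then r else real_of_ereal q * r / (real_of_ereal q - r))"
    and summ: "summable (\<lambda>j. \<Phi> (dyad j) powr - \<kappa> * \<Psi> (dyad j) powr \<kappa>)"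
  shows "\<exists>C>0. \<forall>(f :: 'a::euclidean_space \<Rightarrow> complex). f \<in> borel_measurable borel \<longrightarrow>
    besov_seminorm M s \<Phi> (ereal p) q f < \<infinity> \<longrightarrow>
    (\<Sum>j. ennreal (dyad_weight s \<Psi> j powr r) * enn_powr (Lp_modulus M (ereal p) f (dyad j)) r)
    \<le> ennreal C * enn_powr (besov_seminorm M s \<Phi> (ereal p) q f) r"
proof -
  define y where "y j = \<Psi> (dyad j) / \<Phi> (dyad j)" for j
  have y: "0 < y j" for j using admissible_pos adm by (simp add: y_def)
  have "\<Phi> (dyad j) powr - \<kappa> * \<Psi> (dyad j) powr \<kappa> = y j powr \<kappa>" for j
    using admissible_pos[OF adm(1), of j] admissible_pos[OF adm(2), of j]
    by (simp add: y_def powr_divide powr_minus_divide)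
  then have ysum: "summable (\<lambda>j. y j powr \<kappa>)" using summ by simp
  define Y where "Y = (\<Sum>j. y j powr \<kappa>)"
  have Y0: "0 \<le> Y" unfolding Y_def by (intro suminf_nonneg ysum) simp
  have Y: "(\<Sum>j. ennreal (y j powr \<kappa>)) = ennreal Y"
    unfolding Y_def by (intro suminf_ennreal2 ysum) simp
  define X where "X f j = ennreal (dyad_weight s \<Phi> j) * Lp_modulus M (ereal p) f (dyad j)"
    for f :: "'a \<Rightarrow> complex" and j
  have weighted: "ennreal (dyad_weight s \<Psi> j powr r) * enn_powr (Lp_modulus M (ereal p) f (dyad j)) r
      = ennreal (y j powr r) * enn_powr (X f j) r" for f :: "'a \<Rightarrow> complex" and j
  proof -
    have "dyad_weight s \<Psi> j = y j * dyad_weight s \<Phi> j"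
      using admissible_pos[OF adm(1), of j] by (simp add: y_def dyad_weight_def)
    then show ?thesis
      using y[of j] dyad_weight_pos[OF adm(1), of s j]
      by (simp add: X_def enn_powr_cmult powr_mult ennreal_mult mult.assoc)
  qed
  show ?thesis
  proof (cases "q = \<infinity>")
    case True
    show ?thesis
    proof (intro exI[of _ "Y + 1"] conjI allI impI)
      show "0 < Y + 1" using Y0 by simp
      fix f :: "'a \<Rightarrow> complex"
      let ?S = "besov_seminorm M s \<Phi> (ereal p) q f"
      have "(\<Sum>j. ennreal (y j powr r) * enn_powr (X f j) r) \<le> (\<Sum>j. ennreal (y j powr \<kappa>) * enn_powr ?S r)"
        using dyadic_le_besov_seminorm_infinity[OF adm(1)] r
        by (intro suminf_le allI mult_mono enn_powr_mono) (auto simp: \<kappa> True X_def)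
      also have "\<dots> = ennreal Y * enn_powr ?S r"
        by (simp add: ennreal_suminf_multc Y)
      also have "\<dots> \<le> ennreal (Y + 1) * enn_powr ?S r"
        by (intro mult_right_mono ennreal_leI) auto
      finally show "(\<Sum>j. ennreal (dyad_weight s \<Psi> j powr r) * enn_powr (Lp_modulus M (ereal p) f (dyad j)) r)
          \<le> ennreal (Y + 1) * enn_powr ?S r"
        by (simp only: weighted)
    qed
  next
    case False
    then obtain u where q: "q = ereal u" using p by (cases q) auto
    have u: "0 < u" "r < u" using p r by (auto simp: q)
    have \<kappa>': "\<kappa> = u * r / (u - r)" by (simp add: \<kappa> q)
    obtain A where A: "0 < A" "\<And>f :: 'a \<Rightarrow> complex. f \<in> borel_measurable borel \<Longrightarrow>
        (\<Sum>j. ennreal (dyad_weight s \<Phi> j powr u) * enn_powr (Lp_modulus M (ereal p) f (dyad j)) u)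
        \<le> ennreal A * enn_powr (besov_seminorm M s \<Phi> (ereal p) (ereal u) f) u"
      using dyadic_le_besov_seminorm[OF adm(1) s u(1) p(1), where 'a = 'a and M = M] by auto
    show ?thesis
    proof (intro exI[of _ "A + Y"] conjI allI impI)
      show "0 < A + Y" using Y0 A by simp
      fix f :: "'a \<Rightarrow> complex"
      assume f: "f \<in> borel_measurable borel"
      let ?S = "besov_seminorm M s \<Phi> (ereal p) q f"
      assume "?S < \<infinity>"
      then obtain \<sigma> where \<sigma>: "?S = ennreal \<sigma>" "0 \<le> \<sigma>"
        by (metis ennreal_cases infinity_ennreal_def less_irrefl)
      have XS: "(\<Sum>j. enn_powr (X f j) u) \<le> ennreal A * ennreal (\<sigma> powr u)"
        using A(2)[OF f] \<sigma> dyad_weight_pos[OF adm(1), of s]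
        by (simp add: X_def enn_powr_cmult q enn_powr_ennreal)
      have "(\<Sum>j. ennreal (y j powr r) * enn_powr (X f j) r) \<le> ennreal (A + Y) * enn_powr ?S r"
      \<comment> \<open>Young's inequality needs a positive \<open>\<sigma>\<close>.\<close>
      proof (cases "\<sigma> = 0")
        case True
        have "X f j = 0" for j
        proof -
          have "enn_powr (X f j) u \<le> (\<Sum>j. enn_powr (X f j) u)"
            using sum_le_suminf[of "\<lambda>j. enn_powr (X f j) u" "{j}"] by simp
          then have "enn_powr (X f j) u = 0" using XS True by simp
          then have "enn_powr (enn_powr (X f j) u) (1 / u) = 0" by simp
          then show ?thesis using u by (simp add: enn_powr_powr)
        qed
        then show ?thesis by simp
      next
        case False
        with \<sigma> have \<sigma>0: "0 < \<sigma>" by simp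
        have "(\<Sum>j. ennreal (y j powr r) * enn_powr (X f j) r)
           \<le> (\<Sum>j. ennreal (\<sigma> powr (r - u)) * enn_powr (X f j) u + ennreal (\<sigma> powr r) * ennreal (y j powr \<kappa>))"
          unfolding \<kappa>' by (intro suminf_le allI enn_powr_mult_le_Young y \<sigma>0 r u) auto
        also have "\<dots> = ennreal (\<sigma> powr (r - u)) * (\<Sum>j. enn_powr (X f j) u) + ennreal (\<sigma> powr r) * ennreal Y"
          by (subst suminf_add[symmetric]) (auto simp: Y)
        also have "\<dots> \<le> ennreal (\<sigma> powr (r - u)) * (ennreal A * ennreal (\<sigma> powr u)) + ennreal (\<sigma> powr r) * ennreal Y"
          by (intro add_right_mono mult_left_mono XS) simp
        also have "\<dots> = ennreal (\<sigma> powr (r - u) * (A * \<sigma> powr u) + \<sigma> powr r * Y)"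
          using A Y0 by (simp flip: ennreal_mult ennreal_plus)
        also have "\<sigma> powr (r - u) * (A * \<sigma> powr u) + \<sigma> powr r * Y = (A + Y) * \<sigma> powr r"
          using \<sigma>0 by (simp add: powr_diff algebra_simps)
        also have "ennreal ((A + Y) * \<sigma> powr r) = ennreal (A + Y) * enn_powr ?S r"
          using A Y0 \<sigma> by (simp add: enn_powr_ennreal ennreal_mult)
        finally show ?thesis .
      qed
      then show "(\<Sum>j. ennreal (dyad_weight s \<Psi> j powr r) * enn_powr (Lp_modulus M (ereal p) f (dyad j)) r)
          \<le> ennreal (A + Y) * enn_powr ?S r"
        by (simp only: weighted)
    qed
  qed
qed

section \<open>Restriction to slices for Borel functions\<close>

text \<open>A measurable function outside the space has infinite \<open>L\<^sup>p\<close> quasi-norm or infinite seminorm, so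
  the sum is infinite in that case too. Slices outside the Besov space thus obey the same estimates as the others.\<close>

lemma besov_qnorm_measurable:
  assumes "f \<in> borel_measurable lebesgue"
  shows "besov_qnorm M s \<Psi> p q f = Lp_qnorm p f + besov_seminorm M s \<Psi> p q f"
  using assms
  by (auto simp: besov_qnorm_def besov_space_def Lp_functions_def less_top[symmetric])

text \<open>Each slice is estimated by Borel functions of \<open>y\<close>: its \<open>L\<^sup>p\<close> quasi-norm, and for each \<open>j\<close> the
  slice average at scale \<open>2\<^sup>-\<^sup>j\<close>. Both are integrated over \<open>K\<close>, and the resulting dyadic sum of
  moduli of \<open>f\<close> is bounded by the seminorm of \<open>f\<close>. The nonnegative integral is monotone for arbitrary functions, so
  these majorants settle the integral over \<open>K\<close> whether or not its integrand is measurable.\<close>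

lemma besov_slices_borel:
  fixes q :: ereal and K :: "'b::euclidean_space set"
  assumes adm: "admissible \<Phi>" "admissible \<Psi>" and s: "0 < s" and M: "0 < M" and q: "ereal p < q"
    and r: "0 < r" "r \<le> p"
    and \<kappa>: "\<kappa> = (if q = \<infinity> then r else real_of_ereal q * r / (real_of_ereal q - r))"
    and summ: "summable (\<lambda>j. \<Phi> (dyad j) powr - \<kappa> * \<Psi> (dyad j) powr \<kappa>)"
    and K [measurable]: "K \<in> sets borel" and K_fin: "emeasure lborel K < \<infinity>"
  shows "\<exists>C>0. \<forall>(f :: 'a::euclidean_space \<times> 'b \<Rightarrow> complex). f \<in> borel_measurable borel \<longrightarrow>
    besov_seminorm M s \<Phi> (ereal p) q f < \<infinity> \<longrightarrow>
    (\<integral>\<^sup>+y\<in>K. enn_powr (besov_qnorm M s \<Psi> (ereal p) (ereal r) (\<lambda>x. f (x, y))) r \<partial>lborel)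
    \<le> ennreal C * enn_powr (besov_qnorm M s \<Phi> (ereal p) q f) r"
proof -
  have p: "0 < p" using r by linarith
  have \<theta>: "0 < r / p" "r / p \<le> 1" using r p by auto
  obtain k where k: "emeasure lborel K = ennreal k" "0 \<le> k"
    using K_fin by (metis ennreal_cases infinity_ennreal_def less_irrefl)
  obtain A where A: "0 < A" "\<And>g :: 'a \<Rightarrow> complex.
      enn_powr (besov_seminorm M s \<Psi> (ereal p) (ereal r) g) r
      \<le> ennreal A * (\<Sum>j. ennreal (dyad_weight s \<Psi> j powr r) * enn_powr (Lp_modulus M (ereal p) g (dyad j)) r)"
    using besov_seminorm_le_dyadic[OF adm(2) s r(1), where 'a = 'a and M = M and p = "ereal p"] by auto
  obtain B where B: "0 < B" "\<And>(f :: 'a \<times> 'b \<Rightarrow> complex) t. f \<in> borel_measurable borel \<Longrightarrow> 0 < t \<Longrightarrow>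
      (\<integral>\<^sup>+y. slice_average M p t f y \<partial>lborel) \<le> enn_powr (ennreal B * Lp_modulus M (ereal p) f t) p"
    using slice_average_integral_le_modulus[OF p, where 'a = 'a and 'b = 'b and M = M] by auto
  obtain D where D: "0 < D" "\<And>f :: 'a \<times> 'b \<Rightarrow> complex. f \<in> borel_measurable borel \<Longrightarrow>
      besov_seminorm M s \<Phi> (ereal p) q f < \<infinity> \<Longrightarrow>
      (\<Sum>j. ennreal (dyad_weight s \<Psi> j powr r) * enn_powr (Lp_modulus M (ereal p) f (dyad j)) r)
      \<le> ennreal D * enn_powr (besov_seminorm M s \<Phi> (ereal p) q f) r"
    using dyadic_sum_le_besov_seminorm[OF adm s p q r \<kappa> summ, where 'a = "'a \<times> 'b" and M = M] by auto
  define E where "E = A * ((1 + k) * (B powr r * D))"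
  have E: "0 < E" using A B D k by (simp add: E_def)
  define C where "C = 2 powr r * (1 + k + E)"
  show ?thesis
  proof (intro exI[of _ C] conjI allI impI)
    show "0 < C" using E k by (simp add: C_def)
    fix f :: "'a \<times> 'b \<Rightarrow> complex"
    assume f [measurable]: "f \<in> borel_measurable borel"
      and fin: "besov_seminorm M s \<Phi> (ereal p) q f < \<infinity>"
    \<comment> \<open>\<open>P\<close> and \<open>G j\<close> are the Borel majorants of the two parts of the quasi-norm of a slice.\<close>
    let ?w = "\<lambda>j. ennreal (dyad_weight s \<Psi> j powr r)"
    let ?W = "\<lambda>j. Lp_modulus M (ereal p) f (dyad j)"
    let ?L = "Lp_qnorm (ereal p) f" and ?S = "besov_seminorm M s \<Phi> (ereal p) q f"
    define P where "P y = enn_powr (power_integral p (\<lambda>x. f (x, y))) (r / p)" for y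
    define G where "G j y = enn_powr (slice_average M p (dyad j) f y) (r / p)" for j y
    have [measurable]: "(\<lambda>y. power_integral p (\<lambda>x. f (x, y))) \<in> borel_measurable borel"
      by (intro measurable_power_integral) measurable
    have [measurable]: "P \<in> borel_measurable borel" "G j \<in> borel_measurable borel" for j
      unfolding P_def G_def by measurable
    have slice: "enn_powr (besov_qnorm M s \<Psi> (ereal p) (ereal r) (\<lambda>x. f (x, y))) r
        \<le> ennreal (2 powr r) * (P y + ennreal A * (\<Sum>j. ?w j * G j y))" for y
    proof -
      let ?g = "\<lambda>x. f (x, y)"
      have "?g \<in> borel_measurable lebesgue"
        by (intro measurable_completion) measurable
      then have "enn_powr (besov_qnorm M s \<Psi> (ereal p) (ereal r) ?g) r
          \<le> ennreal (2 powr r) * (enn_powr (Lp_qnorm (ereal p) ?g) r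
              + enn_powr (besov_seminorm M s \<Psi> (ereal p) (ereal r) ?g) r)"
        using enn_powr_add_le[OF r(1)] by (simp add: besov_qnorm_measurable)
      also have "\<dots> \<le> ennreal (2 powr r) * (P y
            + ennreal A * (\<Sum>j. ?w j * enn_powr (Lp_modulus M (ereal p) ?g (dyad j)) r))"
        using A(2)[of ?g] by (intro mult_left_mono add_mono) (auto simp: P_def Lp_qnorm_eq enn_powr_powr)
      also have "\<dots> \<le> ennreal (2 powr r) * (P y + ennreal A * (\<Sum>j. ?w j * G j y))"
      proof (intro mult_left_mono add_left_mono suminf_le allI)
        fix j
        have "enn_powr (Lp_modulus M (ereal p) ?g (dyad j)) r
            \<le> enn_powr (enn_powr (slice_average M p (dyad j) f y) (1 / p)) r"
          using r by (intro enn_powr_mono Lp_modulus_slice_le f M p dyad_pos) auto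
        then show "enn_powr (Lp_modulus M (ereal p) ?g (dyad j)) r \<le> G j y"
          by (simp add: G_def enn_powr_powr)
      qed auto
      finally show ?thesis .
    qed
    have P: "(\<integral>\<^sup>+y\<in>K. P y \<partial>lborel) \<le> ennreal (1 + k) * enn_powr ?L r"
    proof -
      have "(\<integral>\<^sup>+y\<in>K. P y \<partial>lborel) \<le> ennreal (1 + k) * enn_powr (power_integral p f) (r / p)"
        unfolding P_def using k \<theta>
        by (intro nn_integral_enn_powr_le) (auto simp: power_integral_slices)
      then show ?thesis by (simp add: Lp_qnorm_eq enn_powr_powr)
    qed
    have G: "(\<integral>\<^sup>+y\<in>K. G j y \<partial>lborel) \<le> ennreal (1 + k) * (ennreal (B powr r) * enn_powr (?W j) r)" for j
    proof -
      have "(\<integral>\<^sup>+y\<in>K. G j y \<partial>lborel)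
          \<le> ennreal (1 + k) * enn_powr (enn_powr (ennreal B * ?W j) p) (r / p)"
        unfolding G_def using k \<theta> B(2)[OF f dyad_pos, of j]
        by (intro nn_integral_enn_powr_le) auto
      then show ?thesis using p B(1) by (simp add: enn_powr_powr enn_powr_cmult powr_powr)
    qed
    have "(\<integral>\<^sup>+y\<in>K. enn_powr (besov_qnorm M s \<Psi> (ereal p) (ereal r) (\<lambda>x. f (x, y))) r \<partial>lborel)
        \<le> (\<integral>\<^sup>+y\<in>K. (ennreal (2 powr r) * (P y + ennreal A * (\<Sum>j. ?w j * G j y))) \<partial>lborel)"
      by (intro nn_integral_mono mult_right_mono slice) simp
    also have "\<dots> = (\<integral>\<^sup>+y. ennreal (2 powr r) * (P y * indicator K y
        + ennreal A * (\<Sum>j. ?w j * (G j y * indicator K y))) \<partial>lborel)"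
      by (intro nn_integral_cong) (auto split: split_indicator)
    also have "\<dots> = ennreal (2 powr r) * ((\<integral>\<^sup>+y\<in>K. P y \<partial>lborel)
        + ennreal A * (\<Sum>j. ?w j * (\<integral>\<^sup>+y\<in>K. G j y \<partial>lborel)))"
      by (simp add: nn_integral_cmult nn_integral_add nn_integral_suminf)
    also have "\<dots> \<le> ennreal (2 powr r) * (ennreal (1 + k) * enn_powr ?L r
        + ennreal A * (\<Sum>j. ?w j * (ennreal (1 + k) * (ennreal (B powr r) * enn_powr (?W j) r))))"
      by (intro mult_left_mono add_mono P suminf_le allI G) auto
    also have "(\<Sum>j. ?w j * (ennreal (1 + k) * (ennreal (B powr r) * enn_powr (?W j) r)))
        = ennreal (1 + k) * (ennreal (B powr r) * (\<Sum>j. ?w j * enn_powr (?W j) r))"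
      by (simp add: mult.left_commute[of "?w _"] del: ennreal_plus)
    also have "ennreal (2 powr r) * (ennreal (1 + k) * enn_powr ?L r
        + ennreal A * (ennreal (1 + k) * (ennreal (B powr r) * (\<Sum>j. ?w j * enn_powr (?W j) r))))
        \<le> ennreal (2 powr r) * (ennreal (1 + k) * enn_powr ?L r
        + ennreal A * (ennreal (1 + k) * (ennreal (B powr r) * (ennreal D * enn_powr ?S r))))"
      by (intro mult_left_mono add_left_mono D(2) f fin) auto
    also have "\<dots> = ennreal (2 powr r) * (ennreal (1 + k) * enn_powr ?L r + ennreal E * enn_powr ?S r)"
      using A B D k by (simp add: E_def ennreal_mult mult.assoc del: ennreal_plus)
    also have "\<dots> \<le> ennreal (2 powr r) * (ennreal (1 + k) * enn_powr (?L + ?S) r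
        + ennreal E * enn_powr (?L + ?S) r)"
      using r by (intro mult_left_mono add_mono enn_powr_mono) auto
    also have "\<dots> = ennreal C * enn_powr (?L + ?S) r"
      using E k by (simp add: C_def ennreal_mult mult.assoc distrib_right)
    also have "?L + ?S = besov_qnorm M s \<Phi> (ereal p) q f"
      using f by (subst besov_qnorm_measurable) (auto intro: measurable_completion)
    finally show "(\<integral>\<^sup>+y\<in>K. enn_powr (besov_qnorm M s \<Psi> (ereal p) (ereal r) (\<lambda>x. f (x, y))) r \<partial>lborel)
        \<le> ennreal C * enn_powr (besov_qnorm M s \<Phi> (ereal p) q f) r" .
  qed
qed

section \<open>Passing to a Borel representative\<close>

lemma complex_lebesgue_ex_borel:
  fixes f :: "'a::euclidean_space \<Rightarrow> complex"
  assumes f: "f \<in> borel_measurable lebesgue"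
  shows "\<exists>g\<in>borel_measurable borel. AE x in lborel. f x = g x"
proof -
  have "(\<lambda>x. Re (f x)) \<in> borel_measurable lebesgue" "(\<lambda>x. Im (f x)) \<in> borel_measurable lebesgue"
    using f by (auto intro: measurable_compose[OF f])
  from this[THEN completion_ex_borel_measurable_real]
  obtain u v where uv: "u \<in> borel_measurable borel" "AE x in lborel. Re (f x) = u x"
      "v \<in> borel_measurable borel" "AE x in lborel. Im (f x) = v x"
    by auto
  show ?thesis
  proof
    show "(\<lambda>x. complex_of_real (u x) + \<i> * complex_of_real (v x)) \<in> borel_measurable borel"
      using uv by measurable
    show "AE x in lborel. f x = complex_of_real (u x) + \<i> * complex_of_real (v x)"
      using uv(2,4) by eventually_elim (simp add: complex_eq_iff)
  qed
qed

text \<open>Lebesgue measure is complete, so the sets where only one of \<open>f\<close> and \<open>g\<close> has its value in \<open>S\<close>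
  are measurable.\<close>

lemma borel_measurable_lebesgue_cong_AE:
  fixes f :: "'a::euclidean_space \<Rightarrow> complex"
  assumes g: "g \<in> borel_measurable borel" and ae: "AE x in lborel. f x = g x"
  shows "f \<in> borel_measurable lebesgue"
proof (rule measurableI)
  fix S :: "complex set"
  assume S: "S \<in> sets borel"
  have [measurable]: "Measurable.pred lebesgue (\<lambda>x. f x \<in> S \<and> g x \<notin> S)"
      "Measurable.pred lebesgue (\<lambda>x. g x \<in> S \<and> f x \<notin> S)"
    by (rule sets_completion_AE, use ae in eventually_elim, simp)+
  have "g \<in> borel_measurable lebesgue"
    using g by (intro measurable_completion) simp
  with S have [measurable]: "Measurable.pred lebesgue (\<lambda>x. g x \<in> S)" by measurable
  have "Measurable.pred lebesgue (\<lambda>x. (g x \<in> S \<and> \<not> (g x \<in> S \<and> f x \<notin> S)) \<or> (f x \<in> S \<and> g x \<notin> S))"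
    by measurable
  also have "(\<lambda>x. (g x \<in> S \<and> \<not> (g x \<in> S \<and> f x \<notin> S)) \<or> (f x \<in> S \<and> g x \<notin> S)) = (\<lambda>x. f x \<in> S)"
    by auto
  finally show "f -` S \<inter> space lebesgue \<in> sets lebesgue"
    by (simp add: pred_def vimage_def)
qed simp

text \<open>A null set is contained in a Borel null set, and almost all slices of the latter are null sets.\<close>

lemma AE_slices:
  fixes P :: "'a::euclidean_space \<times> 'b::euclidean_space \<Rightarrow> bool"
  assumes "AE z in lborel. P z"
  shows "AE y in lborel. AE x in lborel. P (x, y)"
proof -
  obtain N where N: "N \<in> null_sets lborel" "{z. \<not> P z} \<subseteq> N"
    using assms unfolding eventually_ae_filter by auto
  then have [measurable]: "N \<in> sets (lborel \<Otimes>\<^sub>M lborel)" by (simp only: lborel_prod null_setsD2)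
  have "AE z in lborel \<Otimes>\<^sub>M lborel. z \<notin> N"
    unfolding lborel_prod using N(1) by (rule AE_not_in)
  then have "AE x in lborel. AE y in lborel. (x, y) \<notin> N"
    by (rule lborel_pair.AE_pair)
  then have "AE y in lborel. AE x in lborel. (x, y) \<notin> N"
    by (subst (asm) lborel_pair.AE_commute) measurable
  then show ?thesis using N(2) by (auto elim!: eventually_mono)
qed

lemma AE_fdiff_eq:
  fixes f g :: "'a::euclidean_space \<Rightarrow> complex"
  assumes "AE x in lborel. f x = g x"
  shows "AE x in lborel. fdiff M h f x = fdiff M h g x"
proof -
  have "AE x in lborel. f (x + c) = g (x + c)" for c
  proof -
    have "AE x in lborel. f (c + x) = g (c + x)"
      by (rule AE_distrD[of "(+) c" lborel borel], simp, unfold lborel_distr_plus, rule assms)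
    then show ?thesis by (simp add: add.commute)
  qed
  then have "AE x in lborel. \<forall>j\<in>{..M}. f (x + real j *\<^sub>R h) = g (x + real j *\<^sub>R h)"
    by (subst AE_finite_all) auto
  then show ?thesis by eventually_elim (simp add: fdiff_def)
qed

lemma Lp_qnorm_cong_AE:
  assumes "AE x in lborel. f x = g x"
  shows "Lp_qnorm (ereal p) f = Lp_qnorm (ereal p) g"
proof -
  have "power_integral p f = power_integral p g"
    unfolding power_integral_def by (rule nn_integral_cong_AE) (use assms in eventually_elim, simp)
  then show ?thesis by (simp add: Lp_qnorm_eq)
qed

lemma besov_seminorm_cong_AE:
  assumes "AE x in lborel. f x = g x"
  shows "besov_seminorm M s \<Psi> (ereal p) q f = besov_seminorm M s \<Psi> (ereal p) q g"
proof -
  have "Lp_modulus M (ereal p) f = Lp_modulus M (ereal p) g"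
    by (simp add: Lp_modulus_def[abs_def] Lp_qnorm_cong_AE[OF AE_fdiff_eq[OF assms]])
  then show ?thesis by (simp add: besov_seminorm_def)
qed

text \<open>The Besov quasi-norm is infinite by definition for functions that are not Lebesgue measurable, so
  the proof has to show that \<open>f\<close> inherits measurability from \<open>g\<close>. For the slices of a Lebesgue
  measurable function this is where measurability comes from.\<close>

lemma besov_qnorm_cong_AE:
  assumes g: "g \<in> borel_measurable borel" and ae: "AE x in lborel. f x = g x"
  shows "besov_qnorm M s \<Psi> (ereal p) q f = besov_qnorm M s \<Psi> (ereal p) q g"
proof -
  have "f \<in> borel_measurable lebesgue" "g \<in> borel_measurable lebesgue"
    using borel_measurable_lebesgue_cong_AE g ae by (auto intro: measurable_completion)
  then show ?thesis
    by (simp add: besov_qnorm_measurable Lp_qnorm_cong_AE[OF ae] besov_seminorm_cong_AE[OF ae])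
qed

theorem theorem7p2:
  fixes N d M :: nat and r p s \<kappa> :: real and q :: ereal
    and \<Phi> \<Psi> :: "real \<Rightarrow> real"
    and K :: "(real ^ 'e) set"
  assumes "3 \<le> N" "1 \<le> d" "d < N"
    and "CARD('d::finite) = d" "CARD('e::finite) = N - d"
    and "0 < r" "r \<le> p" "ereal p < q"
    and "sigma_p N p < s"
    and "s < real M"
    and "\<kappa> = (if q = \<infinity> then r else real_of_ereal q * r / (real_of_ereal q - r))"
    and "admissible \<Phi>" "admissible \<Psi>"
    and "summable (\<lambda>j::nat. \<Phi> (2 powr - real j) powr - \<kappa> * \<Psi> (2 powr - real j) powr \<kappa>)"
    and "compact K"
  shows "\<exists>C::real. 0 < C \<and>
    (\<forall>f :: (real ^ 'd) \<times> (real ^ 'e) \<Rightarrow> complex.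
       f \<in> besov_space M s \<Phi> p q \<longrightarrow>
       enn_powr
         (\<integral>\<^sup>+x''\<in>K. enn_powr (besov_qnorm M s \<Psi> p r (\<lambda>x'. f (x', x''))) r \<partial>lebesgue)
         (1 / r)
       \<le> ennreal C * besov_qnorm M s \<Phi> p q f)"
proof -
  have "0 \<le> sigma_p N p" by (simp add: sigma_p_def)
  then have s: "0 < s" "0 < M" using assms(9,10) by auto
  have K: "K \<in> sets borel" "emeasure lborel K < \<infinity>"
    by (rule borel_compact[OF assms(15)], rule emeasure_bounded_finite[OF compact_imp_bounded[OF assms(15)]])
  obtain C where C: "0 < C" "\<And>g :: (real ^ 'd) \<times> (real ^ 'e) \<Rightarrow> complex. g \<in> borel_measurable borel \<Longrightarrow>
      besov_seminorm M s \<Phi> (ereal p) q g < \<infinity> \<Longrightarrow>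
      (\<integral>\<^sup>+y\<in>K. enn_powr (besov_qnorm M s \<Psi> (ereal p) (ereal r) (\<lambda>x. g (x, y))) r \<partial>lborel)
      \<le> ennreal C * enn_powr (besov_qnorm M s \<Phi> (ereal p) q g) r"
    using besov_slices_borel[OF assms(12,13) s assms(8,6,7,11) _ K, where 'a = "real ^ 'd"] assms(14)
    unfolding dyad_def by auto
  show ?thesis
  proof (intro exI[of _ "C powr (1 / r)"] conjI allI impI)
    show "0 < C powr (1 / r)" using C by simp
    fix f :: "(real ^ 'd) \<times> (real ^ 'e) \<Rightarrow> complex"
    assume "f \<in> besov_space M s \<Phi> p q"
    then have f: "f \<in> borel_measurable lebesgue" "besov_seminorm M s \<Phi> p q f < \<infinity>"
      by (auto simp: besov_space_def Lp_functions_def)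
    obtain g where g: "g \<in> borel_measurable borel" "AE z in lborel. f z = g z"
      using complex_lebesgue_ex_borel[OF f(1)] by auto
    have "(\<lambda>x. g (x, y)) \<in> borel_measurable borel" for y
      using g(1) by measurable
    then have "AE y in lborel. besov_qnorm M s \<Psi> p r (\<lambda>x. f (x, y)) = besov_qnorm M s \<Psi> p r (\<lambda>x. g (x, y))"
      using AE_slices[OF g(2)] by (auto elim!: eventually_mono intro!: besov_qnorm_cong_AE)
    then have "(\<integral>\<^sup>+y\<in>K. enn_powr (besov_qnorm M s \<Psi> p r (\<lambda>x. f (x, y))) r \<partial>lebesgue)
        = (\<integral>\<^sup>+y\<in>K. enn_powr (besov_qnorm M s \<Psi> p r (\<lambda>x. g (x, y))) r \<partial>lborel)"
      unfolding nn_integral_completion by (intro nn_integral_cong_AE) (auto elim!: eventually_mono)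
    also have "\<dots> \<le> ennreal C * enn_powr (besov_qnorm M s \<Phi> p q g) r"
      using f(2) by (intro C(2) g(1)) (simp add: besov_seminorm_cong_AE[OF g(2)])
    also have "besov_qnorm M s \<Phi> p q g = besov_qnorm M s \<Phi> p q f"
      by (rule besov_qnorm_cong_AE[OF g, symmetric])
    finally have "enn_powr (\<integral>\<^sup>+y\<in>K. enn_powr (besov_qnorm M s \<Psi> p r (\<lambda>x. f (x, y))) r \<partial>lebesgue) (1 / r)
        \<le> enn_powr (ennreal C * enn_powr (besov_qnorm M s \<Phi> p q f) r) (1 / r)"
      using assms(6) by (intro enn_powr_mono) auto
    then show "enn_powr
         (\<integral>\<^sup>+x''\<in>K. enn_powr (besov_qnorm M s \<Psi> p r (\<lambda>x'. f (x', x''))) r \<partial>lebesgue) (1 / r)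
       \<le> ennreal (C powr (1 / r)) * besov_qnorm M s \<Phi> p q f"
      using C assms(6) by (simp add: enn_powr_cmult enn_powr_powr)
  qed
qed

end
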